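(* Assume the following. (a) For every $i$: with probability $1$, $M_i(t_2,X_i)-M_i(t_1,X_i)=\int_{t_1}^{t_2}M_i'(t,X_i)\,dt$ for all intervals $(t_1,t_2)\subset\Theta$ (with endpoints in $\Theta$); moreover $\mathbf{E}M_i(\theta,X_i)=0$, $\mathbf{E}M_i^2(\theta,X_i)<\infty$, $\mathbf{E}|M_i'(\theta,X_i)|<\infty$. (b) For all sufficiently large $n$, $I_n>0$ and $J_n\neq 0$; moreover $|J_n|/\sqrt{I_n}\to\infty$, $\sum_{i=1}^n M_i'(\theta,X_i)/J_n\xrightarrow{p}1$ and $\sum_{i=1}^n M_i(\theta,X_i)/\sqrt{I_n}\Rightarrow\mathcal{N}(0,1)$. (c) The numbers $J_n$ have the same sign for all sufficiently large $n$. (d) For some $0<\delta_\theta\le\infty$ we have $\limsup_{n\to\infty}\overline\tau_n(\delta_\theta)<1$, and the following law of large numbers, denoted $\mathrm{LLN}(\delta)$, holds with $\delta=\delta_\theta$: $$\sum_{i=1}^n\sup_{t:|t-\theta|\le\delta}M_i'(t,X_i)\Big/\sum_{i=1}^n\mathbf{E}\sup_{t:|t-\theta|\le\delta}M_i'(t,X_i)\xrightarrow{p}1.$$ Then, with probability tending to $1$, on the interval $(\theta-\delta_\theta,\theta+\delta_\theta)$ the function $M_n(t)=\sum_{i=1}^nM_i(t,X_i)$ is strictly monotone (decreasing if $J_n<0$, increasing if $J_n>0$) and changes sign; that is, with probability tending to $1$, on this interval there exists a unique solution $\widetilde\theta_n(\theta)$ of the equation $M_n(t)=0$. If in addition $\lim_{\delta\to0}\limsup_{n\to\infty}\overline\tau_n(\delta)=0$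 and $\mathrm{LLN}(\delta)$ holds for every $\delta=\delta_\theta$ such that $\limsup_{n\to\infty}\overline\tau_n(\delta_\theta)<1$, then $$\frac{J_n}{\sqrt{I_n}}\big(\widetilde\theta_n(\theta)-\theta\big)\Rightarrow\mathcal{N}(0,1).$$
   Context: All limits are as $n\to\infty$ unless stated otherwise; $\xrightarrow{p}$ is convergence in probability, $\Rightarrow$ is weak convergence of distributions. Setting: for each $n$ one observes independent elements $X_1,\dots,X_n$ of an arbitrary measurable space, not necessarily identically distributed. Their distributions depend on an unknown parameter belonging to an open set $\Theta\subset\mathbb{R}$, may also depend on $n$, and may depend on nuisance parameters. The symbol $\theta\in\Theta$ denotes the true value, and $\mathbf{P},\mathbf{E}$ refer to the true distributions. For each $i$ there are given functions $M_i(t,X_i)$ and $M_i'(t,X_i)$ of $t\in\Theta$ (possibly depending on $n$). Notation: $I_n=\sum_{i=1}^n\mathbf{E}M_i^2(\theta,X_i)$, $J_n=\sum_{i=1}^n\mathbf{E}M_i'(\theta,X_i)$, $\overline\tau_n(\delta)=|J_n|^{-1}\sum_{i=1}^n\mathbf{E}\tau_i(\delta,X_i)$, where $\tau_i(\delta,X_i)=\sup_{t:|t-\theta|\le\delta}|M_i'(t,X_i)-M_i'(\theta,X_i)|$ if $[\theta-\delta,\theta+\delta]\subset\Theta$ and $\tau_i(\delta,X_i)=\infty$ otherwise. $\widetilde\theta_n(\theta)$ denotes the root of the equation $M_n(t)=0$ closest to $\theta$ (a random variable depending on $\theta$).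
   Formalization: In the first conclusion, when J_n>0 for large n, LLN(δ_θ) is also assumed for −M_i' (i.e. with inf in place of sup), since with sup alone monotonicity and uniqueness can fail; the case J_n<0 and the asymptotic normality are as stated. *)

theory Defs
  imports "HOL-Probability.Probability"
begin

(* Triangular-array conventions.  P n is the true distribution on the n-th sample space and X n i,
   i = 1..n, are the observations, with values in a measurable space S n.  M n i t x and M' n i t x
   are M_i(t,x) and M_i'(t,x) for the sample size n; only parameters t in Theta are meaningful.
   M' is not required to be a pointwise derivative of M.
   A radius delta ranges over (0, infinity], hence has type ereal. *)

definition cnbhd :: "real \<Rightarrow> ereal \<Rightarrow> real set" where
  "cnbhd \<theta> \<delta> = {t. ereal \<bar>t - \<theta>\<bar> \<le> \<delta>}"

definition onbhd :: "real \<Rightarrow> ereal \<Rightarrow> real set" where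
  "onbhd \<theta> \<delta> = {t. ereal \<bar>t - \<theta>\<bar> < \<delta>}"

definition conv_in_prob :: "(nat \<Rightarrow> 'a measure) \<Rightarrow> (nat \<Rightarrow> 'a \<Rightarrow> real) \<Rightarrow> real \<Rightarrow> bool" where
  "conv_in_prob P Y c \<longleftrightarrow>
     (\<forall>n. Y n \<in> borel_measurable (P n)) \<and>
     (\<forall>\<epsilon>>0. (\<lambda>n. measure (P n) {\<omega> \<in> space (P n). \<bar>Y n \<omega> - c\<bar> > \<epsilon>}) \<longlonglongrightarrow> 0)"

(* "With probability tending to 1".  The set where Q n holds need not be measurable,
   so it is required to contain events whose probabilities tend to 1. *)
definition whp :: "(nat \<Rightarrow> 'a measure) \<Rightarrow> (nat \<Rightarrow> 'a \<Rightarrow> bool) \<Rightarrow> bool" where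
  "whp P Q \<longleftrightarrow>
     (\<exists>A. (\<forall>n. A n \<in> sets (P n)) \<and> (\<forall>n. \<forall>\<omega>\<in>A n. Q n \<omega>) \<and>
          (\<lambda>n. measure (P n) (A n)) \<longlonglongrightarrow> 1)"

definition I_n ::
  "(nat \<Rightarrow> 'a measure) \<Rightarrow> (nat \<Rightarrow> nat \<Rightarrow> 'a \<Rightarrow> 'b) \<Rightarrow> (nat \<Rightarrow> nat \<Rightarrow> real \<Rightarrow> 'b \<Rightarrow> real) \<Rightarrow>
   real \<Rightarrow> nat \<Rightarrow> real" where
  "I_n P X M \<theta> n = (\<Sum>i=1..n. \<integral>\<omega>. (M n i \<theta> (X n i \<omega>))\<^sup>2 \<partial>P n)"

definition J_n ::
  "(nat \<Rightarrow> 'a measure) \<Rightarrow> (nat \<Rightarrow> nat \<Rightarrow> 'a \<Rightarrow> 'b) \<Rightarrow> (nat \<Rightarrow> nat \<Rightarrow> real \<Rightarrow> 'b \<Rightarrow> real) \<Rightarrow>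
   real \<Rightarrow> nat \<Rightarrow> real" where
  "J_n P X M' \<theta> n = (\<Sum>i=1..n. \<integral>\<omega>. M' n i \<theta> (X n i \<omega>) \<partial>P n)"

definition M_n ::
  "(nat \<Rightarrow> nat \<Rightarrow> 'a \<Rightarrow> 'b) \<Rightarrow> (nat \<Rightarrow> nat \<Rightarrow> real \<Rightarrow> 'b \<Rightarrow> real) \<Rightarrow> nat \<Rightarrow> 'a \<Rightarrow> real \<Rightarrow> real" where
  "M_n X M n \<omega> t = (\<Sum>i=1..n. M n i t (X n i \<omega>))"

definition tau ::
  "real set \<Rightarrow> (nat \<Rightarrow> nat \<Rightarrow> real \<Rightarrow> 'b \<Rightarrow> real) \<Rightarrow> real \<Rightarrow> nat \<Rightarrow> nat \<Rightarrow> ereal \<Rightarrow> 'b \<Rightarrow> ennreal" where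
  "tau \<Theta> M' \<theta> n i \<delta> x =
     (if cnbhd \<theta> \<delta> \<subseteq> \<Theta>
      then SUP t\<in>cnbhd \<theta> \<delta>. ennreal \<bar>M' n i t x - M' n i \<theta> x\<bar>
      else \<infinity>)"

definition tau_bar ::
  "(nat \<Rightarrow> 'a measure) \<Rightarrow> (nat \<Rightarrow> nat \<Rightarrow> 'a \<Rightarrow> 'b) \<Rightarrow> real set \<Rightarrow>
   (nat \<Rightarrow> nat \<Rightarrow> real \<Rightarrow> 'b \<Rightarrow> real) \<Rightarrow> real \<Rightarrow> ereal \<Rightarrow> nat \<Rightarrow> ennreal" where
  "tau_bar P X \<Theta> M' \<theta> \<delta> n =
     (\<Sum>i=1..n. \<integral>\<^sup>+\<omega>. tau \<Theta> M' \<theta> n i \<delta> (X n i \<omega>) \<partial>P n) / ennreal \<bar>J_n P X M' \<theta> n\<bar>"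

definition sup_M' ::
  "(nat \<Rightarrow> nat \<Rightarrow> real \<Rightarrow> 'b \<Rightarrow> real) \<Rightarrow> real \<Rightarrow> nat \<Rightarrow> nat \<Rightarrow> ereal \<Rightarrow> 'b \<Rightarrow> ereal" where
  "sup_M' M' \<theta> n i \<delta> x = (SUP t\<in>cnbhd \<theta> \<delta>. ereal (M' n i t x))"

(* The supremum lies in (-infinity, infinity].  Whenever limsup (tau_bar delta) < 1, it is almost
   surely finite and integrable for all large n, so that real_of_ereal then loses nothing.
   An uncountable supremum need not be measurable; that it is a random variable is part of LLN. *)
definition LLN ::
  "(nat \<Rightarrow> 'a measure) \<Rightarrow> (nat \<Rightarrow> nat \<Rightarrow> 'a \<Rightarrow> 'b) \<Rightarrow> (nat \<Rightarrow> nat \<Rightarrow> real \<Rightarrow> 'b \<Rightarrow> real) \<Rightarrow>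
   real \<Rightarrow> ereal \<Rightarrow> bool" where
  "LLN P X M' \<theta> \<delta> \<longleftrightarrow>
     (\<forall>n. \<forall>i\<in>{1..n}. (\<lambda>\<omega>. sup_M' M' \<theta> n i \<delta> (X n i \<omega>)) \<in> borel_measurable (P n)) \<and>
     conv_in_prob P
       (\<lambda>n \<omega>. (\<Sum>i=1..n. real_of_ereal (sup_M' M' \<theta> n i \<delta> (X n i \<omega>))) /
               (\<Sum>i=1..n. \<integral>\<omega>'. real_of_ereal (sup_M' M' \<theta> n i \<delta> (X n i \<omega>')) \<partial>P n)) 1"

definition closest_root :: "real set \<Rightarrow> (real \<Rightarrow> real) \<Rightarrow> real \<Rightarrow> real \<Rightarrow> bool" where
  "closest_root \<Theta> f \<theta> r \<longleftrightarrow>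
     r \<in> \<Theta> \<and> f r = 0 \<and> (\<forall>s\<in>\<Theta>. f s = 0 \<longrightarrow> \<bar>r - \<theta>\<bar> \<le> \<bar>s - \<theta>\<bar>)"

(* A root may fail to exist, and two roots may be equally close to theta.  So the estimator is any
   random variable that almost surely is a closest root whenever there is one: its value where
   there is none, and the choice between two closest roots, are arbitrary. *)
definition closest_root_estimator ::
  "(nat \<Rightarrow> 'a measure) \<Rightarrow> (nat \<Rightarrow> nat \<Rightarrow> 'a \<Rightarrow> 'b) \<Rightarrow> real set \<Rightarrow>
   (nat \<Rightarrow> nat \<Rightarrow> real \<Rightarrow> 'b \<Rightarrow> real) \<Rightarrow> real \<Rightarrow> (nat \<Rightarrow> 'a \<Rightarrow> real) \<Rightarrow> bool" where
  "closest_root_estimator P X \<Theta> M \<theta> T \<longleftrightarrow>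
     (\<forall>n. T n \<in> borel_measurable (P n) \<and>
          (AE \<omega> in P n. (\<exists>r. closest_root \<Theta> (M_n X M n \<omega>) \<theta> r) \<longrightarrow>
                          closest_root \<Theta> (M_n X M n \<omega>) \<theta> (T n \<omega>)))"

end

(*
  For J < 0 the condition limsup tau_bar < 1 bounds the expectation of the sum of the suprema of the
  M_i' by q * J for some q > 0.  By the LLN the random sum is then at most q * J / 2 with probability
  tending to 1, so M_n decreases with slope at least q * |J| / 2 around theta.  Since M_n(theta) has
  variance I, it is small compared with |J|, so M_n changes sign near theta.  The case J > 0 follows
  by passing to -M and -M'.

  For the limit law, Markov's inequality applied to the sum of the tau_i(delta) makes M_n on a small
  neighbourhood of theta linear with slope J up to a relative error 2r.  A root T near theta then
  satisfies |M_n(theta) + J (T - theta)| <= 4r |M_n(theta)|.  Hence J (T - theta) / sqrt I differs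
  from - M_n(theta) / sqrt I by a term that tends to 0 in probability, and N(0,1) is symmetric.
*)

theory Submission
  imports Defs
begin

subsection \<open>Probabilities tending to 1\<close>

text \<open>The slope conditions quantify over uncountably many \<open>t\<close>, so the sets where
  they hold need not be events. Probabilities are therefore tracked through inner events with a
  fixed error \<open>p\<close>: conjunctions only add errors, almost sure implications cost nothing,
  and \<open>p\<close> is sent to 0 at the end. What remains is deterministic. Since
  \<open>M'\<close> is a density of \<open>M\<close> in the sense of the gauge integral and not a
  pointwise derivative, comparison of integrals takes the place of the mean value theorem.

  The law of large numbers for suprema controls \<open>M'\<close> from above. This forces a negative
  slope when J < 0 but gives no lower bound on \<open>M'\<close> when J > 0, which is why the
  reflected case calls for the law for \<open>-M'\<close>.

  In the limit law the error 4r |M_n(theta)| has to be small compared with sqrt I. Chebyshev's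
  inequality achieves this: |M_n(theta)| exceeds the large multiple eps/(4r) of sqrt I only with
  small probability.\<close>

text \<open>As for \<^const>\<open>whp\<close>, the set where \<open>Q n\<close> holds need not be measurable.\<close>

definition eventually_prob :: "(nat \<Rightarrow> 'a measure) \<Rightarrow> real \<Rightarrow> (nat \<Rightarrow> 'a \<Rightarrow> bool) \<Rightarrow> bool" where
  "eventually_prob P p Q \<longleftrightarrow>
     (\<forall>\<^sub>F n in sequentially. \<exists>A\<in>sets (P n). (\<forall>\<omega>\<in>A. Q n \<omega>) \<and> measure (P n) A \<ge> 1 - p)"

lemma whp_mono:
  assumes "whp P Q" "\<And>n \<omega>. Q n \<omega> \<Longrightarrow> R n \<omega>"
  shows "whp P R"
  using assms unfolding whp_def by blast

text \<open>Removing from the inner event the null set where the implication fails leaves its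
  probability unchanged. Properties of the paths that hold only almost surely, such as the integral
  representation, enter in this way.\<close>

lemma eventually_prob_mono:
  assumes "eventually_prob P p Q"
    and "\<forall>\<^sub>F n in sequentially. AE \<omega> in P n. Q n \<omega> \<longrightarrow> R n \<omega>"
  shows "eventually_prob P p R"
  unfolding eventually_prob_def
  using assms(1)[unfolded eventually_prob_def] assms(2)
proof eventually_elim
  case (elim n)
  then obtain A where A: "A \<in> sets (P n)" "\<forall>\<omega>\<in>A. Q n \<omega>" "measure (P n) A \<ge> 1 - p" by blast
  from elim(2) obtain N where N: "N \<in> null_sets (P n)"
      "{\<omega> \<in> space (P n). \<not> (Q n \<omega> \<longrightarrow> R n \<omega>)} \<subseteq> N"
    by (auto elim!: AE_E simp: null_sets_def)
  show ?case
  proof (intro bexI[of _ "A - N"] conjI ballI)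
    show "R n \<omega>" if "\<omega> \<in> A - N" for \<omega>
      using that A N sets.sets_into_space[OF A(1)] by blast
    show "1 - p \<le> measure (P n) (A - N)"
      using A N by (simp add: measure_Diff_null_set)
    show "A - N \<in> sets (P n)" using A N by auto
  qed
qed

lemma eventually_prob_le:
  assumes "eventually_prob P p Q" "p \<le> q"
  shows "eventually_prob P q Q"
  unfolding eventually_prob_def using assms(1)[unfolded eventually_prob_def]
proof eventually_elim
  case (elim n)
  then obtain A where "A \<in> sets (P n)" "\<forall>\<omega>\<in>A. Q n \<omega>" "measure (P n) A \<ge> 1 - p" by blast
  then show ?case using \<open>p \<le> q\<close> by (intro bexI[of _ A]) auto
qed

text \<open>Union bound for the complements: the part of \<open>A\<close> outside \<open>B\<close>
  has probability at most \<open>q\<close>.\<close>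

lemma eventually_prob_conj:
  assumes prob: "\<And>n. prob_space (P n)"
    and "eventually_prob P p Q" "eventually_prob P q R"
  shows "eventually_prob P (p + q) (\<lambda>n \<omega>. Q n \<omega> \<and> R n \<omega>)"
  unfolding eventually_prob_def
  using assms(2,3)[unfolded eventually_prob_def]
proof eventually_elim
  case (elim n)
  interpret prob_space "P n" by (rule prob)
  from elim obtain A B where A: "A \<in> events" "\<forall>\<omega>\<in>A. Q n \<omega>" "prob A \<ge> 1 - p"
    and B: "B \<in> events" "\<forall>\<omega>\<in>B. R n \<omega>" "prob B \<ge> 1 - q" by blast
  have "prob A = prob (A \<inter> B) + prob (A - B)"
    using A B by (subst finite_measure_Union[symmetric]) (auto intro!: arg_cong[where f = prob])
  moreover have "prob (A - B) \<le> prob (space (P n) - B)"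
    using A(1) B(1) sets.sets_into_space by (intro finite_measure_mono) auto
  ultimately have "prob (A \<inter> B) \<ge> 1 - (p + q)"
    using A B prob_compl[OF B(1)] by linarith
  then show ?case using A B by (intro bexI[of _ "A \<inter> B"]) auto
qed

lemma whp_eventually_prob:
  assumes prob: "\<And>n. prob_space (P n)"
    and Q: "\<And>p. p > 0 \<Longrightarrow> eventually_prob P p Q"
  shows "whp P Q"
proof -
  \<comment> \<open>Events that are optimal up to \<open>1 / Suc n\<close> work for all \<open>p\<close> at once.\<close>
  let ?F = "\<lambda>n. {A \<in> sets (P n). \<forall>\<omega>\<in>A. Q n \<omega>}"
  let ?s = "\<lambda>n. SUP A\<in>?F n. measure (P n) A"
  have bdd: "bdd_above (measure (P n) ` ?F n)" for n
    using prob_space.prob_le_1[OF prob] by (intro bdd_aboveI[of _ 1]) auto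
  have "\<exists>A\<in>?F n. measure (P n) A > ?s n - 1 / real (Suc n)" for n
  proof -
    \<comment> \<open>The empty event qualifies vacuously, so a near-optimal event exists for every
      \<open>n\<close>, including the small \<open>n\<close> about which the hypothesis is
      silent.\<close>
    have ne: "?F n \<noteq> {}" by (auto intro!: exI[of _ "{}"])
    have "?s n - 1 / real (Suc n) < ?s n" by simp
    then show ?thesis by (rule less_cSUP_iff[THEN iffD1, OF ne bdd])
  qed
  then have "\<exists>A. A \<in> ?F n \<and> measure (P n) A > ?s n - 1 / real (Suc n)" for n by (simp only: Bex_def)
  then obtain A where A': "\<And>n. A n \<in> ?F n \<and> measure (P n) (A n) > ?s n - 1 / real (Suc n)"
    using choice_iff[of "\<lambda>n A. A \<in> ?F n \<and> measure (P n) A > ?s n - 1 / real (Suc n)"] by blast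
  then have A: "\<And>n. A n \<in> ?F n" "\<And>n. measure (P n) (A n) > ?s n - 1 / real (Suc n)"
    by (rule conjunct1, rule conjunct2)
  have "(\<lambda>n. measure (P n) (A n)) \<longlonglongrightarrow> 1"
  proof (rule order_tendstoI)
    fix a :: real assume "a < 1"
    define p where "p = (1 - a) / 2"
    have p: "p > 0" "a = 1 - 2 * p" using \<open>a < 1\<close> by (auto simp: p_def field_simps)
    have "(\<lambda>n. 1 / real (Suc n)) \<longlonglongrightarrow> 0" using LIMSEQ_inverse_real_of_nat by (simp add: inverse_eq_divide)
    then have "\<forall>\<^sub>F n in sequentially. 1 / real (Suc n) < p"
      using p order_tendstoD(2) by blast
    then show "\<forall>\<^sub>F n in sequentially. a < measure (P n) (A n)"
      using Q[OF p(1), unfolded eventually_prob_def]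
    proof eventually_elim
      case (elim n)
      then obtain B where "B \<in> ?F n" "1 - p \<le> measure (P n) B" by blast
      with cSUP_upper[OF _ bdd, of B n] A(2)[of n] elim(1) p(2) show ?case by auto
    qed
  next
    fix a :: real assume "a > 1"
    then show "\<forall>\<^sub>F n in sequentially. a > measure (P n) (A n)"
      using prob_space.prob_le_1[OF prob] by (intro always_eventually) (meson le_less_trans)
  qed
  with A show ?thesis unfolding whp_def by (intro exI[of _ A]) auto
qed

lemma conv_in_prob_eventually_prob:
  assumes prob: "\<And>n. prob_space (P n)"
    and "conv_in_prob P Y c" "\<epsilon> > 0" "p > 0"
  shows "eventually_prob P p (\<lambda>n \<omega>. \<bar>Y n \<omega> - c\<bar> \<le> \<epsilon>)"
proof -
  have [measurable]: "Y n \<in> borel_measurable (P n)" for n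
    using assms(2) by (simp add: conv_in_prob_def)
  have "(\<lambda>n. measure (P n) {\<omega> \<in> space (P n). \<bar>Y n \<omega> - c\<bar> > \<epsilon>}) \<longlonglongrightarrow> 0"
    using assms by (simp add: conv_in_prob_def)
  then have "\<forall>\<^sub>F n in sequentially. measure (P n) {\<omega> \<in> space (P n). \<bar>Y n \<omega> - c\<bar> > \<epsilon>} < p"
    using \<open>p > 0\<close> by (rule order_tendstoD)
  then show ?thesis unfolding eventually_prob_def
  proof eventually_elim
    case (elim n)
    interpret prob_space "P n" by (rule prob)
    have "prob {\<omega> \<in> space (P n). \<not> \<bar>Y n \<omega> - c\<bar> > \<epsilon>}
        = 1 - prob {\<omega> \<in> space (P n). \<bar>Y n \<omega> - c\<bar> > \<epsilon>}"
      by (rule prob_neg) measurable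
    with elim show ?case
      by (intro bexI[of _ "{\<omega> \<in> space (P n). \<not> \<bar>Y n \<omega> - c\<bar> > \<epsilon>}"]) auto
  qed
qed

lemma conv_in_probI:
  assumes prob: "\<And>n. prob_space (P n)"
    and [measurable]: "\<And>n. Y n \<in> borel_measurable (P n)"
    and Y: "\<And>\<epsilon> p. \<epsilon> > 0 \<Longrightarrow> p > 0 \<Longrightarrow> eventually_prob P p (\<lambda>n \<omega>. \<bar>Y n \<omega> - c\<bar> \<le> \<epsilon>)"
  shows "conv_in_prob P Y c"
  unfolding conv_in_prob_def
proof (intro conjI allI impI)
  fix \<epsilon> :: real assume \<epsilon>: "\<epsilon> > 0"
  show "(\<lambda>n. measure (P n) {\<omega> \<in> space (P n). \<bar>Y n \<omega> - c\<bar> > \<epsilon>}) \<longlonglongrightarrow> 0"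
  proof (rule order_tendstoI)
    fix a :: real assume "a > 0"
    then have "a / 2 > 0" by simp
    from Y[OF \<epsilon> this]
    show "\<forall>\<^sub>F n in sequentially. measure (P n) {\<omega> \<in> space (P n). \<bar>Y n \<omega> - c\<bar> > \<epsilon>} < a"
      unfolding eventually_prob_def
    proof eventually_elim
      case (elim n)
      interpret prob_space "P n" by (rule prob)
      from elim obtain A where A: "A \<in> events" "\<forall>\<omega>\<in>A. \<bar>Y n \<omega> - c\<bar> \<le> \<epsilon>" "1 - a/2 \<le> prob A"
        by blast
      have "prob {\<omega> \<in> space (P n). \<bar>Y n \<omega> - c\<bar> > \<epsilon>} \<le> prob (space (P n) - A)"
        using A by (intro finite_measure_mono) (auto simp: not_less[symmetric])
      then show ?case using A prob_compl[OF A(1)] \<open>a > 0\<close> by linarith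
    qed
  qed (auto intro!: always_eventually intro: less_le_trans)
qed measurable

lemma eventually_prob_measure_compl:
  assumes "\<And>n. {\<omega>\<in>space (P n). \<not> Q n \<omega>} \<in> sets (P n)" "\<And>n. prob_space (P n)"
    and "\<forall>\<^sub>F n in sequentially. measure (P n) {\<omega>\<in>space (P n). \<not> Q n \<omega>} \<le> p"
  shows "eventually_prob P p Q"
  unfolding eventually_prob_def using assms(3)
proof eventually_elim
  case (elim n)
  interpret prob_space "P n" by (rule assms)
  show ?case
    using prob_compl[OF assms(1)[of n]] elim assms(1)[of n]
    by (intro bexI[of _ "space (P n) - {\<omega>\<in>space (P n). \<not> Q n \<omega>}"]) auto
qed

subsection \<open>Characteristic functions and symmetric limits\<close>

text \<open>The factor \<open>iexp y\<close> has modulus 1, which reduces the Lipschitz bound to a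
  comparison with \<open>iexp 0 = 1\<close>.\<close>

lemma norm_iexp_diff_le: "norm (iexp x - iexp y) \<le> \<bar>x - y\<bar>"
proof -
  have "iexp x - iexp y = iexp y * (iexp (x - y) - 1)"
    by (simp add: algebra_simps exp_diff)
  also have "norm \<dots> = norm (iexp (x - y) - 1)" by (simp add: norm_mult)
  also have "\<dots> \<le> \<bar>x - y\<bar>" using iexp_approx1[of "x - y" 0] by simp
  finally show ?thesis .
qed

text \<open>A Slutsky argument: \<open>Z n\<close> is close to \<open>- W n\<close>, so its
  characteristic function at \<open>t\<close> is close to that of \<open>W n\<close> at
  \<open>- t\<close>. The latter converges to \<open>char N (- t)\<close>, which by symmetry is
  \<open>char N t\<close>, and Levy's continuity theorem concludes.\<close>

lemma weak_conv_m_reflect: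
  fixes W Z :: "nat \<Rightarrow> 'a \<Rightarrow> real"
  assumes prob: "\<And>n. prob_space (P n)"
    and [measurable]: "\<And>n. W n \<in> borel_measurable (P n)" "\<And>n. Z n \<in> borel_measurable (P n)"
    and N: "real_distribution N" "\<And>t. char N (- t) = char N t"
    and W: "weak_conv_m (\<lambda>n. distr (P n) borel (W n)) N"
    and WZ: "conv_in_prob P (\<lambda>n \<omega>. W n \<omega> + Z n \<omega>) 0"
  shows "weak_conv_m (\<lambda>n. distr (P n) borel (Z n)) N"
proof -
  have rd: "real_distribution (distr (P n) borel (W n))" "real_distribution (distr (P n) borel (Z n))" for n
    by (auto intro!: prob_space.real_distribution_distr[OF prob])
  show ?thesis
  proof (rule levy_continuity[OF rd(2) N(1)])
    fix t :: real
    let ?W = "\<lambda>n. char (distr (P n) borel (W n)) (- t)"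
      and ?Z = "\<lambda>n. char (distr (P n) borel (Z n)) t"
    have bound: "norm (?Z n - ?W n) \<le> \<bar>t\<bar> * e + 2 * measure (P n) {\<omega> \<in> space (P n). \<bar>W n \<omega> + Z n \<omega> - 0\<bar> > e}"
      if "e > 0" for n e
    proof -
      interpret prob_space "P n" by (rule prob)
      let ?B = "{\<omega> \<in> space (P n). \<bar>W n \<omega> + Z n \<omega> - 0\<bar> > e}"
      have int: "integrable (P n) (\<lambda>\<omega>. iexp (s * Y \<omega>))" if "Y \<in> borel_measurable (P n)" for s Y
        using that by (intro integrable_const_bound[where B=1]) auto
      have "?Z n - ?W n = (\<integral>\<omega>. iexp (t * Z n \<omega>) - iexp ((- t) * W n \<omega>) \<partial>P n)"
        unfolding char_def by (subst Bochner_Integration.integral_diff[OF int int])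
          (simp_all add: integral_distr)
      also have "norm \<dots> \<le> (\<integral>\<omega>. norm (iexp (t * Z n \<omega>) - iexp ((- t) * W n \<omega>)) \<partial>P n)"
        by (rule integral_norm_bound)
      also have "\<dots> \<le> (\<integral>\<omega>. \<bar>t\<bar> * e + 2 * indicator ?B \<omega> \<partial>P n)"
      proof (rule integral_mono)
        show "integrable (P n) (\<lambda>\<omega>. norm (iexp (t * Z n \<omega>) - iexp ((- t) * W n \<omega>)))"
          by (intro integrable_norm Bochner_Integration.integrable_diff int) measurable
        show "integrable (P n) (\<lambda>\<omega>. \<bar>t\<bar> * e + 2 * indicator ?B \<omega>)"
          by (intro Bochner_Integration.integrable_add integrable_const integrable_mult_right
              integrable_real_indicator) (auto simp: emeasure_eq_measure)
        fix \<omega> assume \<omega>: "\<omega> \<in> space (P n)"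
        show "norm (iexp (t * Z n \<omega>) - iexp ((- t) * W n \<omega>)) \<le> \<bar>t\<bar> * e + 2 * indicator ?B \<omega>"
        \<comment> \<open>Off \<open>?B\<close> the Lipschitz bound applies. On \<open>?B\<close>
          there is only the trivial bound 2, but this event has small probability.\<close>
        proof (cases "\<omega> \<in> ?B")
          case True
          have "norm (iexp (t * Z n \<omega>) - iexp ((- t) * W n \<omega>)) \<le> 1 + 1"
            by (rule order.trans[OF norm_triangle_ineq4]) (simp del: of_real_mult)
          then show ?thesis using True that by (simp add: add_increasing)
        next
          case False
          have "norm (iexp (t * Z n \<omega>) - iexp ((- t) * W n \<omega>)) \<le> \<bar>t * Z n \<omega> - (- t) * W n \<omega>\<bar>"
            by (rule norm_iexp_diff_le)
          also have "\<dots> = \<bar>t\<bar> * \<bar>W n \<omega> + Z n \<omega>\<bar>"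
            by (simp add: abs_mult[symmetric] algebra_simps)
          also have "\<dots> \<le> \<bar>t\<bar> * e" using False \<omega> by (intro mult_left_mono) auto
          finally show ?thesis using False by simp
        qed
      qed
      also have "\<dots> = \<bar>t\<bar> * e + 2 * measure (P n) ?B"
        by (subst Bochner_Integration.integral_add) (auto simp: emeasure_eq_measure prob_space)
      finally show ?thesis .
    qed
    have "(\<lambda>n. ?Z n - ?W n) \<longlonglongrightarrow> 0"
    proof (rule tendstoI)
      fix r :: real assume "r > 0"
      \<comment> \<open>Each of the two terms of \<open>bound\<close> gets \<open>r / 2\<close>;
        adding 1 to \<open>\<bar>t\<bar>\<close> keeps the denominator positive at
        \<open>t = 0\<close>.\<close>
      define e where "e = r / (2 * (\<bar>t\<bar> + 1))"
      have e: "e > 0" "\<bar>t\<bar> * e < r / 2" using \<open>r > 0\<close> by (auto simp: e_def field_simps)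
      have "\<forall>\<^sub>F n in sequentially. measure (P n) {\<omega> \<in> space (P n). \<bar>W n \<omega> + Z n \<omega> - 0\<bar> > e} < r / 4"
        using WZ e(1) \<open>r > 0\<close> unfolding conv_in_prob_def by (intro order_tendstoD(2)[of _ 0]) auto
      then show "\<forall>\<^sub>F n in sequentially. dist (?Z n - ?W n) 0 < r"
      proof eventually_elim
        case (elim n)
        then show ?case using bound[OF e(1), of n] e(2) by (auto simp: dist_norm)
      qed
    qed
    moreover have "?W \<longlonglongrightarrow> char N t"
      using levy_continuity1[OF rd(1) N(1) W, of "- t"] N(2) by simp
    ultimately show "?Z \<longlonglongrightarrow> char N t" using tendsto_add by fastforce
  qed
qed

subsection \<open>Roots of functions with slope bounded away from 0\<close>

text \<open>Integrating \<open>g \<le> - k\<close> bounds every difference quotient of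
  \<open>f\<close> by \<open>- k\<close>. Over a distance \<open>\<eta>\<close> the function thus
  falls by at least \<open>k * \<eta>\<close>, more than \<open>\<bar>f \<theta>\<bar>\<close>, so
  it changes sign between \<open>\<theta> - \<eta>\<close> and \<open>\<theta> + \<eta>\<close>. The
  auxiliary radius \<open>\<eta>\<close> is finite even if \<open>\<delta>\<close> is
  infinite.\<close>

lemma integral_strict_antimono_root:
  fixes f g :: "real \<Rightarrow> real"
  assumes int: "\<And>s t. s < t \<Longrightarrow> {s..t} \<subseteq> cnbhd \<theta> \<delta> \<Longrightarrow> (g has_integral f t - f s) {s..t}"
    and g: "\<And>t. t \<in> cnbhd \<theta> \<delta> \<Longrightarrow> g t \<le> - k"
    and k: "k > 0" and \<eta>: "\<eta> > 0" "ereal \<eta> < \<delta>" and f: "\<bar>f \<theta>\<bar> < k * \<eta>"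
    and sub: "onbhd \<theta> \<delta> \<subseteq> \<Theta>"
  shows "strict_antimono_on (onbhd \<theta> \<delta>) f"
    and "\<exists>s\<in>onbhd \<theta> \<delta>. \<exists>t\<in>onbhd \<theta> \<delta>. f s < 0 \<and> 0 < f t"
    and "\<exists>!t. t \<in> onbhd \<theta> \<delta> \<and> f t = 0"
    and "\<exists>t\<in>onbhd \<theta> \<delta>. closest_root \<Theta> f \<theta> t"
proof -
  have conv: "{s..t} \<subseteq> cnbhd \<theta> \<delta>" if "s \<in> cnbhd \<theta> \<delta>" "t \<in> cnbhd \<theta> \<delta>" for s t
  proof
    fix x assume "x \<in> {s..t}"
    then have "\<bar>x - \<theta>\<bar> \<le> max \<bar>s - \<theta>\<bar> \<bar>t - \<theta>\<bar>" by auto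
    then have "ereal \<bar>x - \<theta>\<bar> \<le> ereal (max \<bar>s - \<theta>\<bar> \<bar>t - \<theta>\<bar>)" by (simp only: ereal_less_eq)
    also have "\<dots> \<le> \<delta>" using that by (auto simp: cnbhd_def max_def)
    finally show "x \<in> cnbhd \<theta> \<delta>" by (simp add: cnbhd_def)
  qed
  have oc: "t \<in> cnbhd \<theta> \<delta>" if "t \<in> onbhd \<theta> \<delta>" for t
    using that by (auto simp: cnbhd_def onbhd_def)
  have slope: "f t - f s \<le> - k * (t - s)" if "s < t" "s \<in> cnbhd \<theta> \<delta>" "t \<in> cnbhd \<theta> \<delta>" for s t
  proof -
    have "((\<lambda>_. - k) has_integral (t - s) *\<^sub>R (- k)) {s..t}"
      using has_integral_const_real[of "- k" s t] \<open>s < t\<close> by simp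
    moreover have "(g has_integral f t - f s) {s..t}" using that conv int by blast
    moreover have "\<forall>x\<in>{s..t}. g x \<le> - k" using conv[OF that(2,3)] g by blast
    ultimately have "f t - f s \<le> (t - s) *\<^sub>R (- k)" by (blast intro: has_integral_le)
    then show ?thesis by (simp add: mult.commute)
  qed
  have less: "f t < f s" if "s < t" "s \<in> cnbhd \<theta> \<delta>" "t \<in> cnbhd \<theta> \<delta>" for s t
  proof -
    have "0 < k * (t - s)" using k that by simp
    then show ?thesis using slope[OF that] by simp
  qed
  show anti: "strict_antimono_on (onbhd \<theta> \<delta>) f"
    by (rule monotone_onI) (blast intro: less oc)
  have \<theta>: "\<theta> \<in> onbhd \<theta> \<delta>" "\<theta> + \<eta> \<in> onbhd \<theta> \<delta>" "\<theta> - \<eta> \<in> onbhd \<theta> \<delta>"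
    using \<eta> less_trans[of 0 "ereal \<eta>" \<delta>] by (auto simp: onbhd_def zero_ereal_def)
  have neg: "f (\<theta> + \<eta>) < 0" using slope[of \<theta> "\<theta> + \<eta>"] \<theta> oc \<eta> f by auto
  have pos: "f (\<theta> - \<eta>) > 0" using slope[of "\<theta> - \<eta>" \<theta>] \<theta> oc \<eta> f by auto
  show "\<exists>s\<in>onbhd \<theta> \<delta>. \<exists>t\<in>onbhd \<theta> \<delta>. f s < 0 \<and> 0 < f t" using neg pos \<theta> by blast
  let ?a = "\<theta> - \<eta>" and ?b = "\<theta> + \<eta>"
  have ab: "{?a..?b} \<subseteq> cnbhd \<theta> \<delta>" using conv \<theta> oc by blast
  have "g integrable_on {?a..?b}" using int[of ?a ?b] ab \<eta> by auto
  \<comment> \<open>Continuity of \<open>f\<close> is not assumed: on this interval \<open>f\<close>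
    agrees with an indefinite integral of \<open>g\<close>, which is continuous.\<close>
  then have "continuous_on {?a..?b} (\<lambda>x. f ?a + integral {?a..x} g)"
    by (intro continuous_intros indefinite_integral_continuous_1)
  also have "?this \<longleftrightarrow> continuous_on {?a..?b} f"
  proof (rule continuous_on_cong[OF refl])
    fix x assume x: "x \<in> {?a..?b}"
    then have "(g has_integral f x - f ?a) {?a..x}"
      using ab by (cases "x = ?a") (auto intro!: int)
    then show "f ?a + integral {?a..x} g = f x" by (simp add: integral_unique)
  qed
  finally obtain r where r: "?a \<le> r" "r \<le> ?b" "f r = 0"
    using IVT2'[of f ?b 0 ?a] neg pos \<eta> by auto
  have rn: "r \<in> onbhd \<theta> \<delta>"
  proof -
    have "ereal \<bar>r - \<theta>\<bar> \<le> ereal \<eta>" using r by auto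
    then show ?thesis using \<eta>(2) by (simp only: onbhd_def mem_Collect_eq le_less_trans)
  qed
  have uniq: "s = r" if "s \<in> onbhd \<theta> \<delta>" "f s = 0" for s
    using less[of s r] less[of r s] that r(3) oc[OF rn] oc[OF that(1)] by linarith
  show "\<exists>!t. t \<in> onbhd \<theta> \<delta> \<and> f t = 0" using uniq r rn by blast
  \<comment> \<open>The competitors \<open>s\<close> range beyond the neighbourhood: outside it they
    are at distance at least \<open>\<delta>\<close> from \<open>\<theta>\<close>, hence farther
    away than \<open>r\<close>, and inside it \<open>r\<close> is the only root.\<close>
  have "\<bar>r - \<theta>\<bar> \<le> \<bar>s - \<theta>\<bar>" if "f s = 0" for s
  proof (cases "s \<in> onbhd \<theta> \<delta>")
    case False
    then have "ereal \<bar>r - \<theta>\<bar> < ereal \<bar>s - \<theta>\<bar>"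
      using rn by (simp only: onbhd_def mem_Collect_eq not_less less_le_trans)
    then show ?thesis by simp
  next
    case True
    then show ?thesis using uniq that by blast
  qed
  then show "\<exists>t\<in>onbhd \<theta> \<delta>. closest_root \<Theta> f \<theta> t"
    using rn sub r by (auto simp: closest_root_def)
qed

lemma closest_root_uminus: "closest_root \<Theta> (\<lambda>t. - f t) = closest_root \<Theta> f"
  by (auto simp: closest_root_def fun_eq_iff)

text \<open>The hypotheses give \<open>\<bar>g t - j\<bar> \<le> 2 * r * \<bar>j\<bar> \<le>
  \<bar>j\<bar> / 2\<close>, so the slope has the sign of \<open>j\<close> and modulus at least
  \<open>\<bar>j\<bar> / 2\<close>. The bound \<open>\<delta> / 4 * \<bar>j\<bar>\<close> on
  \<open>\<bar>f \<theta>\<bar>\<close> is this slope times the radius \<open>\<delta> / 2\<close>,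
  as existence of a root requires. Integrating \<open>g - j\<close> then compares \<open>f\<close>
  with its linearization.\<close>

lemma closest_root_deviation:
  fixes f g :: "real \<Rightarrow> real" and \<delta> r j :: real
  assumes int: "\<And>s t. s < t \<Longrightarrow> {s..t} \<subseteq> cnbhd \<theta> \<delta> \<Longrightarrow> (g has_integral f t - f s) {s..t}"
    and g: "\<And>t. t \<in> cnbhd \<theta> \<delta> \<Longrightarrow> \<bar>g t - g \<theta>\<bar> \<le> r * \<bar>j\<bar>"
    and g\<theta>: "\<bar>g \<theta> / j - 1\<bar> \<le> r" and j: "j \<noteq> 0" and r: "0 < r" "r \<le> 1 / 4"
    and \<delta>: "0 < \<delta>" and f: "\<bar>f \<theta>\<bar> < \<delta> / 4 * \<bar>j\<bar>" and sub: "cnbhd \<theta> \<delta> \<subseteq> \<Theta>"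
  shows "\<exists>T. closest_root \<Theta> f \<theta> T"
    and "closest_root \<Theta> f \<theta> T \<Longrightarrow> \<bar>f \<theta> + j * (T - \<theta>)\<bar> \<le> 4 * r * \<bar>f \<theta>\<bar>"
proof -
  have cn: "cnbhd \<theta> \<delta> = {\<theta> - \<delta>..\<theta> + \<delta>}" by (auto simp: cnbhd_def)
  have on: "onbhd \<theta> \<delta> = {\<theta> - \<delta><..<\<theta> + \<delta>}" by (auto simp: onbhd_def)
  have "\<bar>g \<theta> - j\<bar> = \<bar>g \<theta> / j - 1\<bar> * \<bar>j\<bar>" using j by (simp add: abs_mult[symmetric] field_simps)
  also have "\<dots> \<le> r * \<bar>j\<bar>" using g\<theta> by (intro mult_right_mono) auto
  finally have gj: "\<bar>g t - j\<bar> \<le> 2 * r * \<bar>j\<bar>" if "t \<in> cnbhd \<theta> \<delta>" for t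
    using g[OF that] by linarith
  have rj: "2 * r * \<bar>j\<bar> \<le> \<bar>j\<bar> / 2" using mult_right_mono[OF r(2), of "\<bar>j\<bar>"] by simp
  have osub: "onbhd \<theta> \<delta> \<subseteq> \<Theta>" using sub by (auto simp: on cn)
  have k: "\<bar>j\<bar> / 2 > 0" using j by simp
  have \<eta>: "0 < \<delta> / 2" "ereal (\<delta> / 2) < ereal \<delta>" using \<delta> by auto
  have "\<exists>T\<in>onbhd \<theta> \<delta>. closest_root \<Theta> f \<theta> T"
  proof (cases "j < 0")
    case True
    have "g t \<le> - (\<bar>j\<bar> / 2)" if "t \<in> cnbhd \<theta> \<delta>" for t using gj[OF that] rj True by linarith
    with f show ?thesis
      by (intro integral_strict_antimono_root(4)[OF int _ k \<eta> _ osub]) (auto simp: ac_simps)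
  next
    case False
    have "- g t \<le> - (\<bar>j\<bar> / 2)" if "t \<in> cnbhd \<theta> \<delta>" for t
      using gj[OF that] rj False by linarith
    moreover have "((\<lambda>t. - g t) has_integral (- f t) - (- f s)) {s..t}"
      if "s < t" "{s..t} \<subseteq> cnbhd \<theta> \<delta>" for s t
      using has_integral_neg[OF int[OF that]] by simp
    moreover have "\<bar>- f \<theta>\<bar> < \<bar>j\<bar> / 2 * (\<delta> / 2)" using f by (simp add: ac_simps)
    ultimately have "\<exists>T\<in>onbhd \<theta> \<delta>. closest_root \<Theta> (\<lambda>t. - f t) \<theta> T"
      using integral_strict_antimono_root(4)[of \<theta> \<delta> "\<lambda>t. - g t" "\<lambda>t. - f t" "\<bar>j\<bar> / 2" "\<delta> / 2" \<Theta>]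
        k \<eta> osub by blast
    then show ?thesis by (simp add: closest_root_uminus)
  qed
  then obtain T0 where T0: "T0 \<in> onbhd \<theta> \<delta>" "closest_root \<Theta> f \<theta> T0" by blast
  then show "\<exists>T. closest_root \<Theta> f \<theta> T" by blast
  assume T: "closest_root \<Theta> f \<theta> T"
  \<comment> \<open>\<open>T\<close> is only known to be closest among the roots in
    \<open>\<Theta>\<close>; comparison with \<open>T0\<close> places it in the neighbourhood where
    \<open>g\<close> is controlled.\<close>
  then have "\<bar>T - \<theta>\<bar> \<le> \<bar>T0 - \<theta>\<bar>" and fT: "f T = 0" using T0 by (auto simp: closest_root_def)
  then have Tc: "T \<in> cnbhd \<theta> \<delta>" and \<theta>c: "\<theta> \<in> cnbhd \<theta> \<delta>" using T0 by (auto simp: on cn)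
  have lin: "\<bar>f t - f s - j * (t - s)\<bar> \<le> 2 * r * \<bar>j\<bar> * (t - s)"
    if "s < t" "s \<in> cnbhd \<theta> \<delta>" "t \<in> cnbhd \<theta> \<delta>" for s t
  proof -
    have st: "{s..t} \<subseteq> cnbhd \<theta> \<delta>" using that by (auto simp: cn)
    have "((\<lambda>x. g x - j) has_integral (f t - f s) - (t - s) *\<^sub>R j) {s..t}"
      using has_integral_const_real[of j s t] int[OF that(1) st] that(1)
      by (intro has_integral_diff) auto
    then have "norm ((f t - f s) - (t - s) *\<^sub>R j) \<le> 2 * r * \<bar>j\<bar> * measure lborel {s..t}"
      using st gj r by (intro has_integral_bound_real[of _ "{}" "\<lambda>x. g x - j"]) auto
    then show ?thesis using that(1) by (simp add: ac_simps)
  qed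
  have "\<bar>f \<theta> + j * (T - \<theta>)\<bar> \<le> 2 * r * \<bar>j\<bar> * \<bar>T - \<theta>\<bar>"
  proof (cases T \<theta> rule: linorder_cases)
    case less
    then show ?thesis using lin[OF less Tc \<theta>c] fT by (simp add: algebra_simps)
  next
    case greater
    have "f \<theta> + j * (T - \<theta>) = - (f T - f \<theta> - j * (T - \<theta>))" using fT by simp
    then show ?thesis using lin[OF greater \<theta>c Tc] greater by (simp only: abs_minus_cancel)
  qed (use fT in simp)
  also have "\<dots> = 2 * r * \<bar>j * (T - \<theta>)\<bar>" by (simp add: abs_mult)
  finally have *: "\<bar>f \<theta> + j * (T - \<theta>)\<bar> \<le> 2 * r * \<bar>j * (T - \<theta>)\<bar>" .
  \<comment> \<open>The error is proportional to the unknown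
    \<open>\<bar>j * (T - \<theta>)\<bar>\<close>. As its factor is at most 1/2, it can be absorbed,
    giving \<open>\<bar>j * (T - \<theta>)\<bar> \<le> 2 * \<bar>f \<theta>\<bar>\<close>; inserting
    this into the same estimate yields the factor \<open>4 * r\<close>.\<close>
  have "2 * r * \<bar>j * (T - \<theta>)\<bar> \<le> \<bar>j * (T - \<theta>)\<bar> / 2"
    using mult_right_mono[OF r(2), of "\<bar>j * (T - \<theta>)\<bar>"] by simp
  with * have "\<bar>j * (T - \<theta>)\<bar> \<le> 2 * \<bar>f \<theta>\<bar>" by linarith
  then have "2 * r * \<bar>j * (T - \<theta>)\<bar> \<le> 2 * r * (2 * \<bar>f \<theta>\<bar>)"
    using r by (intro mult_left_mono) auto
  with * show "\<bar>f \<theta> + j * (T - \<theta>)\<bar> \<le> 4 * r * \<bar>f \<theta>\<bar>" by linarith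
qed

subsection \<open>Sums of estimating functions\<close>

text \<open>Additivity of variance: in the induction step the new variable is independent of the sum
  of the others, and centring makes the expectation of the cross term vanish.\<close>

lemma (in prob_space) indep_vars_sum_square:
  fixes Y :: "'i \<Rightarrow> 'a \<Rightarrow> real"
  assumes "finite K" "indep_vars (\<lambda>_. borel) Y K"
    and "\<And>i. i \<in> K \<Longrightarrow> integrable M (\<lambda>\<omega>. (Y i \<omega>)\<^sup>2)"
    and "\<And>i. i \<in> K \<Longrightarrow> expectation (Y i) = 0"
  shows "integrable M (\<lambda>\<omega>. (\<Sum>i\<in>K. Y i \<omega>)\<^sup>2)"
    and "expectation (\<lambda>\<omega>. (\<Sum>i\<in>K. Y i \<omega>)\<^sup>2) = (\<Sum>i\<in>K. expectation (\<lambda>\<omega>. (Y i \<omega>)\<^sup>2))"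
  using assms
proof (induction K rule: finite_induct)
  case (insert i K)
  {
    case 1
    let ?S = "\<lambda>\<omega>. \<Sum>i\<in>K. Y i \<omega>"
    have rv: "Y j \<in> borel_measurable M" if "j \<in> insert i K" for j
      using that 1(1) by (auto simp: indep_vars_def)
    have intY: "integrable M (Y j)" if "j \<in> insert i K" for j
      using square_integrable_imp_integrable[OF rv[OF that] 1(2)[OF that]] .
    have intS: "integrable M ?S" by (intro Bochner_Integration.integrable_sum intY) auto
    have S0: "expectation ?S = 0"
      using 1(3) intY by (subst Bochner_Integration.integral_sum) auto
    have indep: "indep_var borel (Y i) borel ?S"
      using insert 1(1) by (intro indep_vars_sum) auto
    have K: "indep_vars (\<lambda>_. borel) Y K" using 1(1) by (rule indep_vars_subset) auto
    have S: "integrable M (\<lambda>\<omega>. (?S \<omega>)\<^sup>2)"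
      "expectation (\<lambda>\<omega>. (?S \<omega>)\<^sup>2) = (\<Sum>i\<in>K. expectation (\<lambda>\<omega>. (Y i \<omega>)\<^sup>2))"
      using insert.IH K 1 by auto
    have prod: "integrable M (\<lambda>\<omega>. Y i \<omega> * ?S \<omega>)" "expectation (\<lambda>\<omega>. Y i \<omega> * ?S \<omega>) = 0"
      using indep_var_integrable[OF indep] indep_var_lebesgue_integral[OF indep] intY intS S0 by auto
    have eq: "(\<lambda>\<omega>. (\<Sum>i\<in>insert i K. Y i \<omega>)\<^sup>2) = (\<lambda>\<omega>. (Y i \<omega>)\<^sup>2 + ((?S \<omega>)\<^sup>2 + 2 * (Y i \<omega> * ?S \<omega>)))"
      using insert.hyps by (auto simp: power2_eq_square algebra_simps)
    note int = 1(2)[of i, simplified] S(1) integrable_mult_right[OF prod(1), of 2]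
    show "integrable M (\<lambda>\<omega>. (\<Sum>i\<in>insert i K. Y i \<omega>)\<^sup>2)"
      unfolding eq by (intro Bochner_Integration.integrable_add int)
    have "expectation (\<lambda>\<omega>. (\<Sum>i\<in>insert i K. Y i \<omega>)\<^sup>2)
        = (\<Sum>i\<in>insert i K. expectation (\<lambda>\<omega>. (Y i \<omega>)\<^sup>2))"
      unfolding eq using insert.hyps S(2) prod
      by (subst Bochner_Integration.integral_add[OF int(1) Bochner_Integration.integrable_add[OF int(2,3)]],
          subst Bochner_Integration.integral_add[OF int(2,3)]) simp
  }
  note * = this
  case 2
  show ?case by (rule *[OF 2])
qed simp_all

lemma M_n_has_integral:
  assumes "\<And>i. i \<in> {1..n} \<Longrightarrow> ((\<lambda>t. M' n i t (X n i \<omega>)) has_integral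
             (M n i t2 (X n i \<omega>) - M n i t1 (X n i \<omega>))) {t1..t2}"
  shows "((\<lambda>t. M_n X M' n \<omega> t) has_integral (M_n X M n \<omega> t2 - M_n X M n \<omega> t1)) {t1..t2}"
  unfolding M_n_def sum_subtractf[symmetric] using assms by (intro has_integral_sum) auto

lemma tau_ge:
  assumes "cnbhd \<theta> \<delta> \<subseteq> \<Theta>" "t \<in> cnbhd \<theta> \<delta>"
  shows "ennreal \<bar>M' n i t x - M' n i \<theta> x\<bar> \<le> tau \<Theta> M' \<theta> n i \<delta> x"
  using assms unfolding tau_def by (auto intro: SUP_upper)

text \<open>The supremum lies between \<open>M' n i \<theta> x\<close> and that value plus
  \<open>tau\<close>, so it is a real number. Finiteness matters because
  \<open>real_of_ereal\<close> sends infinite values to 0, which would destroy the upper bound on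
  \<open>M'\<close>.\<close>

lemma sup_M'_bounds:
  assumes sub: "cnbhd \<theta> \<delta> \<subseteq> \<Theta>" and "0 < \<delta>" and fin: "tau \<Theta> M' \<theta> n i \<delta> x < \<infinity>"
  defines "s \<equiv> real_of_ereal (sup_M' M' \<theta> n i \<delta> x)"
  shows "t \<in> cnbhd \<theta> \<delta> \<Longrightarrow> M' n i t x \<le> s"
    and "s \<le> M' n i \<theta> x + enn2real (tau \<Theta> M' \<theta> n i \<delta> x)"
proof -
  let ?S = "sup_M' M' \<theta> n i \<delta> x" and ?\<tau> = "enn2real (tau \<Theta> M' \<theta> n i \<delta> x)"
  have \<theta>: "\<theta> \<in> cnbhd \<theta> \<delta>" using \<open>0 < \<delta>\<close> by (simp add: cnbhd_def flip: zero_ereal_def)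
  have "\<bar>M' n i t x - M' n i \<theta> x\<bar> \<le> ?\<tau>" if "t \<in> cnbhd \<theta> \<delta>" for t
    using enn2real_mono[OF tau_ge[OF sub that, of M' n i x]] fin by simp
  then have "?S \<le> ereal (M' n i \<theta> x + ?\<tau>)"
    unfolding sup_M'_def by (intro SUP_least) (force simp: abs_le_iff)
  moreover have up: "ereal (M' n i t x) \<le> ?S" if "t \<in> cnbhd \<theta> \<delta>" for t
    unfolding sup_M'_def using that by (intro SUP_upper)
  ultimately obtain r where r: "?S = ereal r" using up[OF \<theta>] by (cases ?S) auto
  then show "t \<in> cnbhd \<theta> \<delta> \<Longrightarrow> M' n i t x \<le> s" "s \<le> M' n i \<theta> x + ?\<tau>"
    using up[of t] \<open>?S \<le> ereal (M' n i \<theta> x + ?\<tau>)\<close> by (auto simp: s_def)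
qed

section \<open>Random estimating functions: bounds in probability and in expectation\<close>

text \<open>These hypotheses are invariant under replacing \<open>M\<close>, \<open>M'\<close> by
  their negatives, so the case of positive \<open>J\<close> can be a second instance. The sign of
  \<open>J\<close> and the law of large numbers for suprema are not invariant and remain assumptions
  of individual lemmas.\<close>

locale estimating_functions =
  fixes P :: "nat \<Rightarrow> 'a measure" and S :: "nat \<Rightarrow> 'b measure"
    and X :: "nat \<Rightarrow> nat \<Rightarrow> 'a \<Rightarrow> 'b"
    and M M' :: "nat \<Rightarrow> nat \<Rightarrow> real \<Rightarrow> 'b \<Rightarrow> real"
    and \<Theta> :: "real set" and \<theta> :: real
  assumes prob: "\<And>n. prob_space (P n)"
    and indep: "\<And>n. prob_space.indep_vars (P n) (\<lambda>_. S n) (X n) {1..n}"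
    and Theta: "\<theta> \<in> \<Theta>"
    and meas_M: "\<And>n i t. i \<in> {1..n} \<Longrightarrow> t \<in> \<Theta> \<Longrightarrow> M n i t \<in> borel_measurable (S n)"
    and meas_tau: "\<And>n i \<delta>. i \<in> {1..n} \<Longrightarrow> 0 < \<delta> \<Longrightarrow>
          (\<lambda>\<omega>. tau \<Theta> M' \<theta> n i \<delta> (X n i \<omega>)) \<in> borel_measurable (P n)"
    and a_integral: "\<And>n i. i \<in> {1..n} \<Longrightarrow>
          AE \<omega> in P n. \<forall>t1 t2. t1 < t2 \<and> {t1..t2} \<subseteq> \<Theta> \<longrightarrow>
            ((\<lambda>t. M' n i t (X n i \<omega>)) has_integral
               (M n i t2 (X n i \<omega>) - M n i t1 (X n i \<omega>))) {t1..t2}"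
    and a_mean: "\<And>n i. i \<in> {1..n} \<Longrightarrow> (\<integral>\<omega>. M n i \<theta> (X n i \<omega>) \<partial>P n) = 0"
    and a_square: "\<And>n i. i \<in> {1..n} \<Longrightarrow> integrable (P n) (\<lambda>\<omega>. (M n i \<theta> (X n i \<omega>))\<^sup>2)"
    and a_deriv: "\<And>n i. i \<in> {1..n} \<Longrightarrow> integrable (P n) (\<lambda>\<omega>. M' n i \<theta> (X n i \<omega>))"
    and b_nonzero: "\<forall>\<^sub>F n in sequentially. I_n P X M \<theta> n > 0 \<and> J_n P X M' \<theta> n \<noteq> 0"
    and b_rate: "filterlim (\<lambda>n. \<bar>J_n P X M' \<theta> n\<bar> / sqrt (I_n P X M \<theta> n)) at_top sequentially"
begin

abbreviation "I \<equiv> I_n P X M \<theta>"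
abbreviation "J \<equiv> J_n P X M' \<theta>"
abbreviation "F \<equiv> M_n X M"
abbreviation "G \<equiv> M_n X M'"

lemma indep_M: "prob_space.indep_vars (P n) (\<lambda>_. borel) (\<lambda>i \<omega>. M n i \<theta> (X n i \<omega>)) {1..n}"
  by (rule prob_space.indep_vars_compose2[OF prob indep]) (auto intro: meas_M Theta)

lemma measurable_M [measurable]: "(\<lambda>\<omega>. F n \<omega> \<theta>) \<in> borel_measurable (P n)"
  unfolding M_n_def using indep_M[of n]
  by (intro borel_measurable_sum) (auto simp: prob_space.indep_vars_def[OF prob])

text \<open>Chebyshev's inequality, \<open>I n\<close> being the variance of the sum at
  \<open>\<theta>\<close> by independence and centring.\<close>

lemma prob_M_ge:
  assumes "a > 0"
  shows "measure (P n) {\<omega>\<in>space (P n). \<bar>F n \<omega> \<theta>\<bar> \<ge> a} \<le> I n / a\<^sup>2"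
proof -
  interpret prob_space "P n" by (rule prob)
  note sq = indep_vars_sum_square[OF finite_atLeastAtMost indep_M a_square a_mean]
  have "expectation (\<lambda>\<omega>. (F n \<omega> \<theta>)\<^sup>2) = I n" unfolding M_n_def I_n_def by (rule sq(2)) auto
  moreover have "integrable (P n) (\<lambda>\<omega>. (F n \<omega> \<theta>)\<^sup>2)" unfolding M_n_def by (rule sq(1)) auto
  ultimately show ?thesis using second_moment_method[OF measurable_M _ \<open>a > 0\<close>] by simp
qed

lemma eventually_prob_M_small:
  assumes "k > 0" "p > 0"
  shows "eventually_prob P p (\<lambda>n \<omega>. \<bar>F n \<omega> \<theta>\<bar> < k * \<bar>J n\<bar>)"
proof (rule eventually_prob_measure_compl[OF _ prob])
  show "\<forall>\<^sub>F n in sequentially. measure (P n) {\<omega>\<in>space (P n). \<not> \<bar>F n \<omega> \<theta>\<bar> < k * \<bar>J n\<bar>} \<le> p"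
    using b_nonzero filterlim_at_top_dense[THEN iffD1, OF b_rate, rule_format, of "1 / (k * sqrt p)"]
  proof eventually_elim
    case (elim n)
    \<comment> \<open>The threshold \<open>1 / (k * sqrt p)\<close> for the rate is the one at which
      Chebyshev's bound at level \<open>k * \<bar>J n\<bar>\<close> becomes
      \<open>p\<close>.\<close>
    have "sqrt (I n) < \<bar>J n\<bar> * (k * sqrt p)"
      using elim assms by (simp add: field_simps)
    then have "(sqrt (I n))\<^sup>2 \<le> (\<bar>J n\<bar> * (k * sqrt p))\<^sup>2"
      using elim by (intro power_mono) auto
    then have "I n \<le> p * (k * \<bar>J n\<bar>)\<^sup>2"
      using elim assms by (simp add: power_mult_distrib ac_simps)
    then have "I n / (k * \<bar>J n\<bar>)\<^sup>2 \<le> p"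
      using elim assms by (simp add: divide_le_eq)
    then show ?case
      using prob_M_ge[of "k * \<bar>J n\<bar>" n] elim assms by (simp add: not_less)
  qed
qed measurable

lemma AE_has_integral:
  "AE \<omega> in P n. \<forall>t1 t2. t1 < t2 \<and> {t1..t2} \<subseteq> \<Theta> \<longrightarrow> (G n \<omega> has_integral F n \<omega> t2 - F n \<omega> t1) {t1..t2}"
proof -
  have "AE \<omega> in P n. \<forall>i\<in>{1..n}. \<forall>t1 t2. t1 < t2 \<and> {t1..t2} \<subseteq> \<Theta> \<longrightarrow>
            ((\<lambda>t. M' n i t (X n i \<omega>)) has_integral
               (M n i t2 (X n i \<omega>) - M n i t1 (X n i \<omega>))) {t1..t2}"
    using a_integral by (subst AE_finite_all) auto
  then show ?thesis
    by eventually_elim (intro allI impI M_n_has_integral, blast)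
qed

lemma eventually_tau_less:
  assumes "limsup (tau_bar P X \<Theta> M' \<theta> \<delta>) < ennreal q" "q \<ge> 0"
  shows "\<forall>\<^sub>F n in sequentially. cnbhd \<theta> \<delta> \<subseteq> \<Theta> \<and> J n \<noteq> 0 \<and>
    (\<Sum>i=1..n. \<integral>\<^sup>+\<omega>. tau \<Theta> M' \<theta> n i \<delta> (X n i \<omega>) \<partial>P n) < ennreal (q * \<bar>J n\<bar>)"
  using Limsup_lessD[OF assms(1)] b_nonzero eventually_ge_at_top[of 1]
proof eventually_elim
  case (elim n)
  let ?T = "\<lambda>i. \<integral>\<^sup>+\<omega>. tau \<Theta> M' \<theta> n i \<delta> (X n i \<omega>) \<partial>P n"
  have less: "(\<Sum>i=1..n. ?T i) < ennreal (q * \<bar>J n\<bar>)"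
    using elim \<open>q \<ge> 0\<close> by (simp add: tau_bar_def divide_less_ennreal ennreal_mult)
  \<comment> \<open>Otherwise \<open>tau\<close> is constantly infinite by its default value, and so
    is its expectation. The restriction to \<open>n \<ge> 1\<close> ensures that the sum has a term
    to show this.\<close>
  moreover have "cnbhd \<theta> \<delta> \<subseteq> \<Theta>"
  proof (rule ccontr)
    assume "\<not> cnbhd \<theta> \<delta> \<subseteq> \<Theta>"
    then have "?T 1 = \<infinity>"
      using prob_space.emeasure_space_1[OF prob] by (simp add: tau_def)
    have "?T 1 \<le> (\<Sum>i=1..n. ?T i)" using elim by (intro member_le_sum) auto
    also note less
    finally show False using \<open>?T 1 = \<infinity>\<close> by simp
  qed
  ultimately show ?case using elim by simp
qed

text \<open>Finite expectation makes each \<open>tau\<close> finite almost surely. The sandwich of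
  the supremum between \<open>M'\<close> at \<open>\<theta>\<close> and \<open>M'\<close> at
  \<open>\<theta>\<close> plus \<open>tau\<close> then holds almost surely; it gives integrability
  by domination, and summing expectations gives \<open>J n + c\<close>.\<close>

lemma sum_sup_M'_bounds:
  assumes sub: "cnbhd \<theta> \<delta> \<subseteq> \<Theta>" and \<delta>: "0 < \<delta>"
    and tau: "(\<Sum>i=1..n. \<integral>\<^sup>+\<omega>. tau \<Theta> M' \<theta> n i \<delta> (X n i \<omega>) \<partial>P n) < ennreal c"
    and meas: "\<And>i. i \<in> {1..n} \<Longrightarrow> (\<lambda>\<omega>. sup_M' M' \<theta> n i \<delta> (X n i \<omega>)) \<in> borel_measurable (P n)"
  defines "s \<equiv> \<lambda>i \<omega>. real_of_ereal (sup_M' M' \<theta> n i \<delta> (X n i \<omega>))"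
  shows "AE \<omega> in P n. \<forall>t\<in>cnbhd \<theta> \<delta>. G n \<omega> t \<le> (\<Sum>i=1..n. s i \<omega>)"
    and "(\<Sum>i=1..n. \<integral>\<omega>. s i \<omega> \<partial>P n) \<le> J n + c"
proof -
  let ?\<tau> = "\<lambda>i \<omega>. tau \<Theta> M' \<theta> n i \<delta> (X n i \<omega>)"
  let ?r = "\<lambda>i \<omega>. enn2real (?\<tau> i \<omega>)"
  have \<theta>: "\<theta> \<in> cnbhd \<theta> \<delta>" using \<delta> by (simp add: cnbhd_def flip: zero_ereal_def)
  \<comment> \<open>\<open>ennreal\<close> truncates negative numbers to 0, below which nothing
    lies. Positivity is what later allows the strict inequality to be read in the reals.\<close>
  have "c > 0" using tau by (metis ennreal_neg linorder_not_le not_less_zero)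
  have fin: "(\<integral>\<^sup>+\<omega>. ?\<tau> i \<omega> \<partial>P n) < \<infinity>" if "i \<in> {1..n}" for i
  proof -
    have "(\<integral>\<^sup>+\<omega>. ?\<tau> i \<omega> \<partial>P n) \<le> (\<Sum>i=1..n. \<integral>\<^sup>+\<omega>. ?\<tau> i \<omega> \<partial>P n)"
      using that by (intro member_le_sum) auto
    also note tau
    finally show ?thesis by (simp add: less_top order.strict_trans)
  qed
  have AE_fin: "AE \<omega> in P n. ?\<tau> i \<omega> < \<infinity>" if "i \<in> {1..n}" for i
    using nn_integral_PInf_AE[OF meas_tau[OF that \<delta>]] fin[OF that] by (auto simp: less_top)
  have "AE \<omega> in P n. \<forall>i\<in>{1..n}. ?\<tau> i \<omega> < \<infinity>" using AE_fin by (subst AE_finite_all) auto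
  then show "AE \<omega> in P n. \<forall>t\<in>cnbhd \<theta> \<delta>. G n \<omega> t \<le> (\<Sum>i=1..n. s i \<omega>)"
    by eventually_elim (auto simp: M_n_def s_def intro!: sum_mono sup_M'_bounds(1)[OF sub \<delta>])
  have nn: "(\<integral>\<^sup>+\<omega>. ennreal (?r i \<omega>) \<partial>P n) = (\<integral>\<^sup>+\<omega>. ?\<tau> i \<omega> \<partial>P n)" if "i \<in> {1..n}" for i
    using AE_fin[OF that] by (intro nn_integral_cong_AE) (auto simp: less_top)
  have r: "integrable (P n) (?r i)" if "i \<in> {1..n}" for i
    using that nn[OF that] fin[OF that] meas_tau[OF that \<delta>] by (intro integrableI_nonneg) auto
  have bounds: "AE \<omega> in P n. M' n i \<theta> (X n i \<omega>) \<le> s i \<omega> \<and> s i \<omega> \<le> M' n i \<theta> (X n i \<omega>) + ?r i \<omega>"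
    if "i \<in> {1..n}" for i
    using AE_fin[OF that] by eventually_elim
      (auto simp: s_def intro!: sup_M'_bounds(1)[OF sub \<delta> _ \<theta>] sup_M'_bounds(2)[OF sub \<delta>])
  have s_int: "integrable (P n) (s i)" if "i \<in> {1..n}" for i
  proof (rule Bochner_Integration.integrable_bound)
    show "integrable (P n) (\<lambda>\<omega>. \<bar>M' n i \<theta> (X n i \<omega>)\<bar> + ?r i \<omega>)"
      using a_deriv r that by auto
    show "s i \<in> borel_measurable (P n)" unfolding s_def using meas[OF that] by measurable
    show "AE \<omega> in P n. norm (s i \<omega>) \<le> norm (\<bar>M' n i \<theta> (X n i \<omega>)\<bar> + ?r i \<omega>)"
      using bounds[OF that] by eventually_elim auto
  qed
  have "(\<Sum>i=1..n. \<integral>\<omega>. s i \<omega> \<partial>P n) \<le> (\<Sum>i=1..n. (\<integral>\<omega>. M' n i \<theta> (X n i \<omega>) \<partial>P n) + (\<integral>\<omega>. ?r i \<omega> \<partial>P n))"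
  proof (rule sum_mono)
    fix i assume i: "i \<in> {1..n}"
    have "(\<integral>\<omega>. s i \<omega> \<partial>P n) \<le> (\<integral>\<omega>. M' n i \<theta> (X n i \<omega>) + ?r i \<omega> \<partial>P n)"
      using bounds[OF i] by (intro integral_mono_AE s_int Bochner_Integration.integrable_add a_deriv r i) auto
    then show "(\<integral>\<omega>. s i \<omega> \<partial>P n) \<le> (\<integral>\<omega>. M' n i \<theta> (X n i \<omega>) \<partial>P n) + (\<integral>\<omega>. ?r i \<omega> \<partial>P n)"
      unfolding Bochner_Integration.integral_add[OF a_deriv[OF i] r[OF i]] .
  qed
  also have "\<dots> = J n + (\<Sum>i=1..n. \<integral>\<omega>. ?r i \<omega> \<partial>P n)"
    by (simp add: J_n_def sum.distrib)
  also have "(\<Sum>i=1..n. \<integral>\<omega>. ?r i \<omega> \<partial>P n) \<le> c"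
  proof -
    have "ennreal (\<Sum>i=1..n. \<integral>\<omega>. ?r i \<omega> \<partial>P n) = (\<Sum>i=1..n. \<integral>\<^sup>+\<omega>. ?\<tau> i \<omega> \<partial>P n)"
      by (subst sum_ennreal[symmetric])
        (auto simp: nn nn_integral_eq_integral[symmetric] r simp del: One_nat_def intro!: sum.cong)
    then have "ennreal (\<Sum>i=1..n. \<integral>\<omega>. ?r i \<omega> \<partial>P n) < ennreal c" using tau by simp
    then show ?thesis using \<open>c > 0\<close> by (simp add: ennreal_less_iff sum_nonneg del: sum_ennreal)
  qed
  finally show "(\<Sum>i=1..n. \<integral>\<omega>. s i \<omega> \<partial>P n) \<le> J n + c" by simp
qed

section \<open>Monotonicity and the unique root for negative \<open>J\<close>\<close>

text \<open>With \<open>q < 1\<close> above the limsup, the expected sum of suprema is at most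
  \<open>J n + q * \<bar>J n\<bar> = - ((1 - q) * \<bar>J n\<bar>)\<close>. Half of this is given up
  to the law of large numbers, whence \<open>k = (1 - q) / 2\<close>. The constant \<open>k\<close>
  is the same for all \<open>p\<close>.\<close>

lemma eventually_prob_slope:
  assumes neg: "\<forall>\<^sub>F n in sequentially. J n < 0" and \<delta>: "0 < \<delta>"
    and tau: "limsup (tau_bar P X \<Theta> M' \<theta> \<delta>) < 1" and lln: "LLN P X M' \<theta> \<delta>"
  obtains k where "k > 0"
    "\<And>p. p > 0 \<Longrightarrow> eventually_prob P p (\<lambda>n \<omega>. \<forall>t\<in>cnbhd \<theta> \<delta>. G n \<omega> t \<le> - (k * \<bar>J n\<bar>))"
proof -
  obtain z where z: "limsup (tau_bar P X \<Theta> M' \<theta> \<delta>) < z" "z < 1" using dense[OF tau] by blast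
  then obtain q where q: "z = ennreal q" "0 \<le> q" by (cases z) auto
  with z have q1: "q < 1" by (simp add: ennreal_less_one_iff)
  let ?s = "\<lambda>n i \<omega>. real_of_ereal (sup_M' M' \<theta> n i \<delta> (X n i \<omega>))"
  let ?E = "\<lambda>n. \<Sum>i=1..n. \<integral>\<omega>. ?s n i \<omega> \<partial>P n"
  have conv: "conv_in_prob P (\<lambda>n \<omega>. (\<Sum>i=1..n. ?s n i \<omega>) / ?E n) 1"
    using lln by (simp add: LLN_def)
  show ?thesis
  proof (rule that)
    show "(1 - q) / 2 > 0" using q1 by simp
    fix p :: real assume "p > 0"
    have lln': "eventually_prob P p (\<lambda>n \<omega>. \<bar>(\<Sum>i=1..n. ?s n i \<omega>) / ?E n - 1\<bar> \<le> 1/2)"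
      by (rule conv_in_prob_eventually_prob[OF prob conv]) (use \<open>p > 0\<close> in auto)
    show "eventually_prob P p (\<lambda>n \<omega>. \<forall>t\<in>cnbhd \<theta> \<delta>. G n \<omega> t \<le> - ((1 - q) / 2 * \<bar>J n\<bar>))"
    proof (rule eventually_prob_mono[OF lln'])
      show "\<forall>\<^sub>F n in sequentially. AE \<omega> in P n. \<bar>(\<Sum>i=1..n. ?s n i \<omega>) / ?E n - 1\<bar> \<le> 1/2 \<longrightarrow>
          (\<forall>t\<in>cnbhd \<theta> \<delta>. G n \<omega> t \<le> - ((1 - q) / 2 * \<bar>J n\<bar>))"
        using neg eventually_tau_less[OF z(1)[unfolded q(1)] q(2)]
      proof eventually_elim
        case (elim n)
        have meas: "(\<lambda>\<omega>. sup_M' M' \<theta> n i \<delta> (X n i \<omega>)) \<in> borel_measurable (P n)" if "i \<in> {1..n}" for i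
          using lln that unfolding LLN_def by blast
        have "?E n \<le> J n + q * \<bar>J n\<bar>"
          by (rule sum_sup_M'_bounds(2)[OF _ \<delta> _ meas]) (use elim in auto)
        also have "\<dots> = - ((1 - q) * \<bar>J n\<bar>)" using elim by (simp add: algebra_simps)
        finally have E: "?E n \<le> - ((1 - q) * \<bar>J n\<bar>)" .
        have "(1 - q) * \<bar>J n\<bar> > 0" using elim q1 by (intro mult_pos_pos) auto
        with E have "?E n < 0" by linarith
        have "AE \<omega> in P n. \<forall>t\<in>cnbhd \<theta> \<delta>. G n \<omega> t \<le> (\<Sum>i=1..n. ?s n i \<omega>)"
          by (rule sum_sup_M'_bounds(1)[OF _ \<delta> _ meas]) (use elim in auto)
        then show ?case
        proof eventually_elim
          case (elim \<omega>)
          show ?case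
          proof (intro impI ballI)
            fix t assume h: "\<bar>(\<Sum>i=1..n. ?s n i \<omega>) / ?E n - 1\<bar> \<le> 1/2" "t \<in> cnbhd \<theta> \<delta>"
            \<comment> \<open>The denominator \<open>?E n\<close> is negative, so a lower bound on
              the ratio becomes an upper bound on the random sum.\<close>
            then have "1 / 2 \<le> (\<Sum>i=1..n. ?s n i \<omega>) / ?E n" by linarith
            then have "(\<Sum>i=1..n. ?s n i \<omega>) \<le> 1 / 2 * ?E n"
              using \<open>?E n < 0\<close> by (simp add: neg_le_divide_eq)
            with elim h(2) E show "G n \<omega> t \<le> - ((1 - q) / 2 * \<bar>J n\<bar>)" by fastforce
          qed
        qed
      qed
    qed
  qed
qed

text \<open>The sign of \<open>J n\<close> is part of the conclusion so that the two implications of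
  the theorem can be decided for each single \<open>n\<close>, not just for large ones.\<close>

lemma whp_strict_antimono_root:
  assumes neg: "\<forall>\<^sub>F n in sequentially. J n < 0" and \<delta>: "0 < \<delta>"
    and tau: "limsup (tau_bar P X \<Theta> M' \<theta> \<delta>) < 1" and lln: "LLN P X M' \<theta> \<delta>"
  shows "whp P (\<lambda>n \<omega>. strict_antimono_on (onbhd \<theta> \<delta>) (F n \<omega>) \<and>
    (\<exists>s\<in>onbhd \<theta> \<delta>. \<exists>t\<in>onbhd \<theta> \<delta>. F n \<omega> s < 0 \<and> 0 < F n \<omega> t) \<and>
    (\<exists>!t. t \<in> onbhd \<theta> \<delta> \<and> F n \<omega> t = 0) \<and>
    (\<exists>t\<in>onbhd \<theta> \<delta>. closest_root \<Theta> (F n \<omega>) \<theta> t) \<and> J n < 0)" (is "whp P ?Q")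
proof (rule whp_eventually_prob[OF prob])
  fix p :: real assume "p > 0"
  obtain k where k: "k > 0"
    "\<And>p. p > 0 \<Longrightarrow> eventually_prob P p (\<lambda>n \<omega>. \<forall>t\<in>cnbhd \<theta> \<delta>. G n \<omega> t \<le> - (k * \<bar>J n\<bar>))"
    using eventually_prob_slope[OF assms] by blast
  \<comment> \<open>As \<open>\<delta>\<close> may be infinite, a finite radius is chosen inside it;
    the slope over this radius has to beat \<open>\<bar>F n \<omega> \<theta>\<bar>\<close>.\<close>
  obtain z where "0 < z" "z < \<delta>" using dense[OF \<delta>] by blast
  then obtain \<eta> where \<eta>: "\<eta> > 0" "ereal \<eta> < \<delta>" by (cases z) auto
  have "eventually_prob P (p/2 + p/2) (\<lambda>n \<omega>. (\<forall>t\<in>cnbhd \<theta> \<delta>. G n \<omega> t \<le> - (k * \<bar>J n\<bar>)) \<and>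
      \<bar>F n \<omega> \<theta>\<bar> < (k * \<eta>) * \<bar>J n\<bar>)"
    using k \<eta> \<open>p > 0\<close> by (intro eventually_prob_conj[OF prob] k eventually_prob_M_small) auto
  then have "eventually_prob P p (\<lambda>n \<omega>. (\<forall>t\<in>cnbhd \<theta> \<delta>. G n \<omega> t \<le> - (k * \<bar>J n\<bar>)) \<and>
      \<bar>F n \<omega> \<theta>\<bar> < (k * \<eta>) * \<bar>J n\<bar>)" by simp
  then show "eventually_prob P p ?Q"
  proof (rule eventually_prob_mono)
    have "limsup (tau_bar P X \<Theta> M' \<theta> \<delta>) < ennreal 1" using tau by simp
    from neg eventually_tau_less[OF this zero_le_one]
    show "\<forall>\<^sub>F n in sequentially. AE \<omega> in P n. (\<forall>t\<in>cnbhd \<theta> \<delta>. G n \<omega> t \<le> - (k * \<bar>J n\<bar>)) \<and>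
      \<bar>F n \<omega> \<theta>\<bar> < (k * \<eta>) * \<bar>J n\<bar> \<longrightarrow> ?Q n \<omega>"
    proof eventually_elim
      case (elim n)
      then have sub: "cnbhd \<theta> \<delta> \<subseteq> \<Theta>" by simp
      have osub: "onbhd \<theta> \<delta> \<subseteq> \<Theta>" using sub by (force simp: onbhd_def cnbhd_def)
      from AE_has_integral show ?case
      proof eventually_elim
        case (elim \<omega>)
        have "?Q n \<omega>" if h: "\<forall>t\<in>cnbhd \<theta> \<delta>. G n \<omega> t \<le> - (k * \<bar>J n\<bar>)" "\<bar>F n \<omega> \<theta>\<bar> < (k * \<eta>) * \<bar>J n\<bar>"
        proof -
          note root = integral_strict_antimono_root[of \<theta> \<delta> "G n \<omega>" "F n \<omega>" "k * \<bar>J n\<bar>" \<eta> \<Theta>]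
          have "s < t \<Longrightarrow> {s..t} \<subseteq> cnbhd \<theta> \<delta> \<Longrightarrow> (G n \<omega> has_integral F n \<omega> t - F n \<omega> s) {s..t}" for s t
            using elim sub by blast
          moreover have "\<bar>F n \<omega> \<theta>\<bar> < k * \<bar>J n\<bar> * \<eta>" using h by (simp add: ac_simps)
          moreover have "k * \<bar>J n\<bar> > 0" using k \<open>J n < 0\<close> by (intro mult_pos_pos) auto
          ultimately show ?thesis
            using root h(1) \<eta> osub \<open>J n < 0\<close> by blast
        qed
        then show ?case by blast
      qed
    qed
  qed
qed

section \<open>Linearization at the closest root\<close>

text \<open>Markov's inequality at level \<open>r * \<bar>J n\<bar>\<close>: an expectation below
  \<open>r * r * \<bar>J n\<bar>\<close> leaves an exceptional probability of at most
  \<open>r\<close>. It is applied to the measurable sum of the \<open>tau\<close>, which dominates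
  the deviation of \<open>G\<close> for all \<open>t\<close> simultaneously.\<close>

lemma eventually_prob_tau_small:
  assumes \<delta>: "0 < \<delta>" and r: "r > 0" and tau: "limsup (tau_bar P X \<Theta> M' \<theta> \<delta>) < ennreal (r * r)"
  shows "eventually_prob P r (\<lambda>n \<omega>. \<forall>t\<in>cnbhd \<theta> \<delta>. \<bar>G n \<omega> t - G n \<omega> \<theta>\<bar> \<le> r * \<bar>J n\<bar>)"
proof -
  let ?\<tau> = "\<lambda>n i \<omega>. tau \<Theta> M' \<theta> n i \<delta> (X n i \<omega>)"
  let ?T = "\<lambda>n \<omega>. \<Sum>i=1..n. ?\<tau> n i \<omega>"
  have ev: "\<forall>\<^sub>F n in sequentially. cnbhd \<theta> \<delta> \<subseteq> \<Theta> \<and> J n \<noteq> 0 \<and>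
      (\<Sum>i=1..n. \<integral>\<^sup>+\<omega>. ?\<tau> n i \<omega> \<partial>P n) < ennreal (r * r * \<bar>J n\<bar>)"
    using tau by (rule eventually_tau_less) simp
  have meas: "?T n \<in> borel_measurable (P n)" for n
    using meas_tau[OF _ \<delta>] by (intro borel_measurable_sum) auto
  have "eventually_prob P r (\<lambda>n \<omega>. ?T n \<omega> \<le> ennreal (r * \<bar>J n\<bar>))"
  proof (rule eventually_prob_measure_compl[OF _ prob])
    show B: "{\<omega> \<in> space (P n). \<not> ?T n \<omega> \<le> ennreal (r * \<bar>J n\<bar>)} \<in> sets (P n)" for n
      using meas[of n] by measurable
    show "\<forall>\<^sub>F n in sequentially. measure (P n) {\<omega> \<in> space (P n). \<not> ?T n \<omega> \<le> ennreal (r * \<bar>J n\<bar>)} \<le> r"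
      using ev
    proof eventually_elim
      case (elim n)
      interpret prob_space "P n" by (rule prob)
      let ?B = "{\<omega> \<in> space (P n). \<not> ?T n \<omega> \<le> ennreal (r * \<bar>J n\<bar>)}"
      have "ennreal (r * \<bar>J n\<bar> * prob ?B) = ennreal (r * \<bar>J n\<bar>) * emeasure (P n) ?B"
        using r by (simp add: emeasure_eq_measure ennreal_mult)
      also have "\<dots> = (\<integral>\<^sup>+\<omega>. ennreal (r * \<bar>J n\<bar>) * indicator ?B \<omega> \<partial>P n)"
        using B by (simp add: nn_integral_cmult_indicator)
      also have "\<dots> \<le> (\<integral>\<^sup>+\<omega>. ?T n \<omega> \<partial>P n)"
        by (intro nn_integral_mono) (auto split: split_indicator)
      also have "\<dots> = (\<Sum>i=1..n. \<integral>\<^sup>+\<omega>. ?\<tau> n i \<omega> \<partial>P n)"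
        using meas_tau[OF _ \<delta>] by (intro nn_integral_sum) auto
      also have "\<dots> < ennreal (r * r * \<bar>J n\<bar>)" using elim by simp
      finally have "r * \<bar>J n\<bar> * prob ?B < r * r * \<bar>J n\<bar>"
        using r by (subst (asm) ennreal_less_iff) auto
      then have "(r * \<bar>J n\<bar>) * prob ?B < (r * \<bar>J n\<bar>) * r" by (simp add: ac_simps)
      moreover have "r * \<bar>J n\<bar> > 0" using r elim by simp
      ultimately show ?case by (simp only: mult_less_cancel_left_pos less_imp_le)
    qed
  qed
  then show ?thesis
  proof (rule eventually_prob_mono)
    show "\<forall>\<^sub>F n in sequentially. AE \<omega> in P n. ?T n \<omega> \<le> ennreal (r * \<bar>J n\<bar>) \<longrightarrow>
        (\<forall>t\<in>cnbhd \<theta> \<delta>. \<bar>G n \<omega> t - G n \<omega> \<theta>\<bar> \<le> r * \<bar>J n\<bar>)"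
      using ev
    proof eventually_elim
      case (elim n)
      show ?case
      proof (intro AE_I2 impI ballI)
        fix \<omega> t assume T: "?T n \<omega> \<le> ennreal (r * \<bar>J n\<bar>)" and t: "t \<in> cnbhd \<theta> \<delta>"
        let ?d = "\<lambda>i. \<bar>M' n i t (X n i \<omega>) - M' n i \<theta> (X n i \<omega>)\<bar>"
        have "ennreal (\<Sum>i=1..n. ?d i) = (\<Sum>i=1..n. ennreal (?d i))"
          by (rule sum_ennreal[symmetric]) simp
        also have "\<dots> \<le> ?T n \<omega>" using elim t by (intro sum_mono tau_ge) auto
        also note T
        finally have "(\<Sum>i=1..n. ?d i) \<le> r * \<bar>J n\<bar>" using r by (subst (asm) ennreal_le_iff) auto
        moreover have "\<bar>G n \<omega> t - G n \<omega> \<theta>\<bar> \<le> (\<Sum>i=1..n. ?d i)"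
          unfolding M_n_def sum_subtractf[symmetric] by (rule sum_abs)
        ultimately show "\<bar>G n \<omega> t - G n \<omega> \<theta>\<bar> \<le> r * \<bar>J n\<bar>" by linarith
      qed
    qed
  qed
qed

lemma closest_root_linearization:
  assumes b_lln: "conv_in_prob P (\<lambda>n \<omega>. G n \<omega> \<theta> / J n) 1"
    and tau: "((\<lambda>\<delta>. limsup (tau_bar P X \<Theta> M' \<theta> (ereal \<delta>))) \<longlongrightarrow> 0) (at_right 0)"
    and T: "closest_root_estimator P X \<Theta> M \<theta> T"
  shows "conv_in_prob P (\<lambda>n \<omega>. F n \<omega> \<theta> / sqrt (I n) + J n / sqrt (I n) * (T n \<omega> - \<theta>)) 0"
proof (rule conv_in_probI[OF prob])
  have [measurable]: "T n \<in> borel_measurable (P n)" for n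
    using T by (simp add: closest_root_estimator_def)
  show "(\<lambda>\<omega>. F n \<omega> \<theta> / sqrt (I n) + J n / sqrt (I n) * (T n \<omega> - \<theta>)) \<in> borel_measurable (P n)" for n
    by measurable
  fix \<epsilon> p :: real assume \<epsilon>: "\<epsilon> > 0" and p: "p > 0"
  \<comment> \<open>\<open>1 / 4\<close> is required by \<open>closest_root_deviation\<close>, and
    \<open>p / 6\<close> keeps the total error of \<open>?A\<close>, \<open>?B\<close>,
    \<open>?C\<close> below \<open>p / 2\<close>. Chebyshev's bound for the failure of
    \<open>?D\<close> is \<open>16 * r * r / \<epsilon>\<^sup>2\<close>; estimating one factor
    \<open>r\<close> by 1, the last entry makes it at most \<open>p / 2\<close>. The radius
    \<open>\<delta>\<close> is chosen only after \<open>r\<close>.\<close>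
  define r where "r = Min {1 / 4, p / 6, p * \<epsilon>\<^sup>2 / 32}"
  have r: "r > 0" "r \<le> 1 / 4" "r \<le> p / 6" "r \<le> p * \<epsilon>\<^sup>2 / 32" using \<epsilon> p by (auto simp: r_def)
  have "\<forall>\<^sub>F \<delta> in at_right 0. limsup (tau_bar P X \<Theta> M' \<theta> (ereal \<delta>)) < ennreal (r * r)"
    using tau r by (intro order_tendstoD(2)) (auto simp: ennreal_zero_less_mult_iff)
  then obtain b where "b > 0" "\<And>\<delta>. 0 < \<delta> \<Longrightarrow> \<delta> < b \<Longrightarrow> limsup (tau_bar P X \<Theta> M' \<theta> (ereal \<delta>)) < ennreal (r * r)"
    by (auto simp: eventually_at_right_field)
  then obtain \<delta> :: real where \<delta>: "\<delta> > 0" "limsup (tau_bar P X \<Theta> M' \<theta> (ereal \<delta>)) < ennreal (r * r)"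
    using dense by blast
  let ?A = "\<lambda>n \<omega>. \<forall>t\<in>cnbhd \<theta> \<delta>. \<bar>G n \<omega> t - G n \<omega> \<theta>\<bar> \<le> r * \<bar>J n\<bar>"
  let ?B = "\<lambda>n \<omega>. \<bar>G n \<omega> \<theta> / J n - 1\<bar> \<le> r"
  let ?C = "\<lambda>n \<omega>. \<bar>F n \<omega> \<theta>\<bar> < \<delta> / 4 * \<bar>J n\<bar>"
  let ?D = "\<lambda>n \<omega>. \<bar>F n \<omega> \<theta>\<bar> < \<epsilon> / (4 * r) * sqrt (I n)"
  have A: "eventually_prob P r ?A" using \<delta> r by (intro eventually_prob_tau_small) auto
  have B: "eventually_prob P r ?B" by (rule conv_in_prob_eventually_prob[OF prob b_lln r(1) r(1)])
  have C: "eventually_prob P r ?C" using \<delta> r by (intro eventually_prob_M_small) auto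
  have D: "eventually_prob P (p / 2) ?D"
  proof (rule eventually_prob_measure_compl[OF _ prob])
    show "\<forall>\<^sub>F n in sequentially. measure (P n) {\<omega> \<in> space (P n). \<not> ?D n \<omega>} \<le> p / 2"
      using b_nonzero
    proof eventually_elim
      case (elim n)
      have "measure (P n) {\<omega> \<in> space (P n). \<not> ?D n \<omega>} \<le> I n / (\<epsilon> / (4 * r) * sqrt (I n))\<^sup>2"
        using prob_M_ge[of "\<epsilon> / (4 * r) * sqrt (I n)" n] elim r \<epsilon> by (simp add: not_less)
      also have "\<dots> = 16 * r * r / \<epsilon>\<^sup>2"
        using elim r \<epsilon> by (simp add: power_mult_distrib power_divide field_simps power2_eq_square)
      also have "\<dots> \<le> 16 * r * 1 / \<epsilon>\<^sup>2"
        using r by (intro divide_right_mono mult_left_mono) auto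
      also have "\<dots> \<le> p / 2" using r \<epsilon> by (simp add: divide_le_eq)
      finally show ?case .
    qed
  qed measurable
  have "eventually_prob P (r + r + r + p / 2) (\<lambda>n \<omega>. ((?A n \<omega> \<and> ?B n \<omega>) \<and> ?C n \<omega>) \<and> ?D n \<omega>)"
    by (intro eventually_prob_conj[OF prob] A B C D)
  then have "eventually_prob P p (\<lambda>n \<omega>. ((?A n \<omega> \<and> ?B n \<omega>) \<and> ?C n \<omega>) \<and> ?D n \<omega>)"
    by (rule eventually_prob_le) (use r in linarith)
  then show "eventually_prob P p
      (\<lambda>n \<omega>. \<bar>F n \<omega> \<theta> / sqrt (I n) + J n / sqrt (I n) * (T n \<omega> - \<theta>) - 0\<bar> \<le> \<epsilon>)"
  proof (rule eventually_prob_mono)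
    show "\<forall>\<^sub>F n in sequentially. AE \<omega> in P n. ((?A n \<omega> \<and> ?B n \<omega>) \<and> ?C n \<omega>) \<and> ?D n \<omega> \<longrightarrow>
        \<bar>F n \<omega> \<theta> / sqrt (I n) + J n / sqrt (I n) * (T n \<omega> - \<theta>) - 0\<bar> \<le> \<epsilon>"
      using b_nonzero eventually_tau_less[OF \<delta>(2) zero_le_square]
    proof eventually_elim
      case (elim n)
      have sub: "cnbhd \<theta> \<delta> \<subseteq> \<Theta>" and nz: "J n \<noteq> 0" "I n > 0" using elim r by auto
      have "AE \<omega> in P n. (\<exists>r. closest_root \<Theta> (F n \<omega>) \<theta> r) \<longrightarrow> closest_root \<Theta> (F n \<omega>) \<theta> (T n \<omega>)"
        using T by (simp add: closest_root_estimator_def)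
      with AE_has_integral[of n] show ?case
      proof eventually_elim
        case (elim \<omega>)
        show ?case
        proof
          assume h: "((?A n \<omega> \<and> ?B n \<omega>) \<and> ?C n \<omega>) \<and> ?D n \<omega>"
          have int: "(G n \<omega> has_integral F n \<omega> t - F n \<omega> s) {s..t}"
            if "s < t" "{s..t} \<subseteq> cnbhd \<theta> \<delta>" for s t
            using elim(1) that sub by blast
          note dev = closest_root_deviation[of \<theta> \<delta> "G n \<omega>" "F n \<omega>" r "J n" \<Theta>,
              OF int _ _ nz(1) r(1,2) \<delta>(1) _ sub]
          have "\<exists>r. closest_root \<Theta> (F n \<omega>) \<theta> r" using h by (intro dev(1)) auto
          with elim(2) have "closest_root \<Theta> (F n \<omega>) \<theta> (T n \<omega>)" by blast
          then have "\<bar>F n \<omega> \<theta> + J n * (T n \<omega> - \<theta>)\<bar> \<le> 4 * r * \<bar>F n \<omega> \<theta>\<bar>"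
            using h by (intro dev(2)) auto
          also have "\<dots> \<le> 4 * r * (\<epsilon> / (4 * r) * sqrt (I n))"
            using h r by (intro mult_left_mono) auto
          also have "\<dots> = \<epsilon> * sqrt (I n)" using r by simp
          finally have "\<bar>F n \<omega> \<theta> + J n * (T n \<omega> - \<theta>)\<bar> / sqrt (I n) \<le> \<epsilon>"
            using nz by (simp add: divide_le_eq)
          also have "\<bar>F n \<omega> \<theta> + J n * (T n \<omega> - \<theta>)\<bar> / sqrt (I n)
              = \<bar>(F n \<omega> \<theta> + J n * (T n \<omega> - \<theta>)) / sqrt (I n)\<bar>"
            using nz by (simp add: abs_divide)
          finally show "\<bar>F n \<omega> \<theta> / sqrt (I n) + J n / sqrt (I n) * (T n \<omega> - \<theta>) - 0\<bar> \<le> \<epsilon>"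
            by (simp add: add_divide_distrib)
        qed
      qed
    qed
  qed
qed

end

section \<open>Reflection to \<open>-M\<close> and \<open>-M'\<close>, and conclusion\<close>

lemma I_n_uminus: "I_n P X (\<lambda>n i t x. - M n i t x) \<theta> = I_n P X M \<theta>"
  by (simp add: I_n_def fun_eq_iff)

lemma J_n_uminus: "J_n P X (\<lambda>n i t x. - M' n i t x) \<theta> n = - J_n P X M' \<theta> n"
  by (simp add: J_n_def sum_negf)

lemma M_n_uminus: "M_n X (\<lambda>n i t x. - M n i t x) n \<omega> = (\<lambda>t. - M_n X M n \<omega> t)"
  by (simp add: M_n_def sum_negf fun_eq_iff)

lemma tau_uminus: "tau \<Theta> (\<lambda>n i t x. - M' n i t x) \<theta> = tau \<Theta> M' \<theta>"
  by (simp add: tau_def fun_eq_iff abs_minus_commute)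

lemma tau_bar_uminus: "tau_bar P X \<Theta> (\<lambda>n i t x. - M' n i t x) \<theta> = tau_bar P X \<Theta> M' \<theta>"
  by (simp add: tau_bar_def tau_uminus J_n_uminus fun_eq_iff)

lemma (in estimating_functions) uminus:
  "estimating_functions P S X (\<lambda>n i t x. - M n i t x) (\<lambda>n i t x. - M' n i t x) \<Theta> \<theta>"
proof (rule estimating_functions.intro[OF prob indep Theta])
  fix n i :: nat assume i: "i \<in> {1..n}"
  show "AE \<omega> in P n. \<forall>t1 t2. t1 < t2 \<and> {t1..t2} \<subseteq> \<Theta> \<longrightarrow>
            ((\<lambda>t. - M' n i t (X n i \<omega>)) has_integral
               (- M n i t2 (X n i \<omega>) - - M n i t1 (X n i \<omega>))) {t1..t2}"
    using a_integral[OF i]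
  proof eventually_elim
    case (elim \<omega>)
    show ?case
    proof (intro allI impI)
      fix t1 t2 assume "t1 < t2 \<and> {t1..t2} \<subseteq> \<Theta>"
      then have "((\<lambda>t. M' n i t (X n i \<omega>)) has_integral
          (M n i t2 (X n i \<omega>) - M n i t1 (X n i \<omega>))) {t1..t2}" using elim by blast
      from has_integral_neg[OF this] show "((\<lambda>t. - M' n i t (X n i \<omega>)) has_integral
          (- M n i t2 (X n i \<omega>) - - M n i t1 (X n i \<omega>))) {t1..t2}" by simp
    qed
  qed
  show "(\<integral>\<omega>. - M n i \<theta> (X n i \<omega>) \<partial>P n) = 0"
    using a_mean[OF i] by simp
  show "integrable (P n) (\<lambda>\<omega>. (- M n i \<theta> (X n i \<omega>))\<^sup>2)"
    using a_square[OF i] by simp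
  show "integrable (P n) (\<lambda>\<omega>. - M' n i \<theta> (X n i \<omega>))"
    using a_deriv[OF i] by simp
  show "(\<lambda>\<omega>. tau \<Theta> (\<lambda>n i t x. - M' n i t x) \<theta> n i \<delta> (X n i \<omega>)) \<in> borel_measurable (P n)"
    if "0 < \<delta>" for \<delta>
    unfolding tau_uminus using i that by (rule meas_tau)
  show "(\<lambda>x. - M n i t x) \<in> borel_measurable (S n)" if "t \<in> \<Theta>" for t
    using meas_M[OF i that] by simp
next
  show "\<forall>\<^sub>F n in sequentially. I_n P X (\<lambda>n i t x. - M n i t x) \<theta> n > 0 \<and>
      J_n P X (\<lambda>n i t x. - M' n i t x) \<theta> n \<noteq> 0"
    using b_nonzero by (simp add: I_n_uminus J_n_uminus)
  show "filterlim (\<lambda>n. \<bar>J_n P X (\<lambda>n i t x. - M' n i t x) \<theta> n\<bar> / sqrt (I_n P X (\<lambda>n i t x. - M n i t x) \<theta> n))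
      at_top sequentially"
    using b_rate by (simp add: I_n_uminus J_n_uminus)
qed

theorem mainTheorem5:
  fixes P :: "nat \<Rightarrow> 'a measure" and S :: "nat \<Rightarrow> 'b measure"
    and X :: "nat \<Rightarrow> nat \<Rightarrow> 'a \<Rightarrow> 'b"
    and M M' :: "nat \<Rightarrow> nat \<Rightarrow> real \<Rightarrow> 'b \<Rightarrow> real"
    and \<Theta> :: "real set" and \<theta> :: real and \<delta>\<^sub>\<theta> :: ereal
  assumes prob: "\<And>n. prob_space (P n)"
    and indep: "\<And>n. prob_space.indep_vars (P n) (\<lambda>_. S n) (X n) {1..n}"
    and Theta: "open \<Theta>" "\<theta> \<in> \<Theta>"
    and meas_M: "\<And>n i t. i \<in> {1..n} \<Longrightarrow> t \<in> \<Theta> \<Longrightarrow> M n i t \<in> borel_measurable (S n)"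
    and meas_M': "\<And>n i t. i \<in> {1..n} \<Longrightarrow> t \<in> \<Theta> \<Longrightarrow> M' n i t \<in> borel_measurable (S n)"
    and meas_tau: "\<And>n i \<delta>. i \<in> {1..n} \<Longrightarrow> 0 < \<delta> \<Longrightarrow>
          (\<lambda>\<omega>. tau \<Theta> M' \<theta> n i \<delta> (X n i \<omega>)) \<in> borel_measurable (P n)"
    and a_integral: "\<And>n i. i \<in> {1..n} \<Longrightarrow>
          AE \<omega> in P n. \<forall>t1 t2. t1 < t2 \<and> {t1..t2} \<subseteq> \<Theta> \<longrightarrow>
            ((\<lambda>t. M' n i t (X n i \<omega>)) has_integral
               (M n i t2 (X n i \<omega>) - M n i t1 (X n i \<omega>))) {t1..t2}"
    and a_mean: "\<And>n i. i \<in> {1..n} \<Longrightarrow> (\<integral>\<omega>. M n i \<theta> (X n i \<omega>) \<partial>P n) = 0"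
    and a_square: "\<And>n i. i \<in> {1..n} \<Longrightarrow> integrable (P n) (\<lambda>\<omega>. (M n i \<theta> (X n i \<omega>))\<^sup>2)"
    and a_deriv: "\<And>n i. i \<in> {1..n} \<Longrightarrow> integrable (P n) (\<lambda>\<omega>. M' n i \<theta> (X n i \<omega>))"
    and b_nonzero: "\<forall>\<^sub>F n in sequentially. I_n P X M \<theta> n > 0 \<and> J_n P X M' \<theta> n \<noteq> 0"
    and b_rate: "filterlim (\<lambda>n. \<bar>J_n P X M' \<theta> n\<bar> / sqrt (I_n P X M \<theta> n)) at_top sequentially"
    and b_lln: "conv_in_prob P (\<lambda>n \<omega>. (\<Sum>i=1..n. M' n i \<theta> (X n i \<omega>)) / J_n P X M' \<theta> n) 1"
    and b_clt: "weak_conv_m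
          (\<lambda>n. distr (P n) borel (\<lambda>\<omega>. (\<Sum>i=1..n. M n i \<theta> (X n i \<omega>)) / sqrt (I_n P X M \<theta> n)))
          std_normal_distribution"
    and c_sign: "(\<forall>\<^sub>F n in sequentially. J_n P X M' \<theta> n < 0) \<or>
                 (\<forall>\<^sub>F n in sequentially. J_n P X M' \<theta> n > 0)"
    and d_delta: "0 < \<delta>\<^sub>\<theta>"
    and d_tau: "limsup (tau_bar P X \<Theta> M' \<theta> \<delta>\<^sub>\<theta>) < 1"
    and d_lln: "LLN P X M' \<theta> \<delta>\<^sub>\<theta>"
  shows
    \<comment> \<open>The law of large numbers for suprema bounds the sum of the M' from above only, which suffices
        when J < 0.  When J > 0 it has to hold for infima, i.e. for -M', as well:
        otherwise monotonicity and uniqueness can fail.\<close>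
    "(((\<forall>\<^sub>F n in sequentially. J_n P X M' \<theta> n > 0) \<longrightarrow>
         LLN P X (\<lambda>n i t x. - M' n i t x) \<theta> \<delta>\<^sub>\<theta>) \<longrightarrow>
      whp P (\<lambda>n \<omega>.
        (J_n P X M' \<theta> n < 0 \<longrightarrow> strict_antimono_on (onbhd \<theta> \<delta>\<^sub>\<theta>) (M_n X M n \<omega>)) \<and>
        (J_n P X M' \<theta> n > 0 \<longrightarrow> strict_mono_on (onbhd \<theta> \<delta>\<^sub>\<theta>) (M_n X M n \<omega>)) \<and>
        (\<exists>s\<in>onbhd \<theta> \<delta>\<^sub>\<theta>. \<exists>t\<in>onbhd \<theta> \<delta>\<^sub>\<theta>. M_n X M n \<omega> s < 0 \<and> 0 < M_n X M n \<omega> t) \<and>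
        (\<exists>!t. t \<in> onbhd \<theta> \<delta>\<^sub>\<theta> \<and> M_n X M n \<omega> t = 0) \<and>
        (\<exists>t\<in>onbhd \<theta> \<delta>\<^sub>\<theta>. closest_root \<Theta> (M_n X M n \<omega>) \<theta> t)))
     \<and>
     (((\<lambda>\<delta>. limsup (tau_bar P X \<Theta> M' \<theta> (ereal \<delta>))) \<longlongrightarrow> 0) (at_right 0) \<and>
      (\<forall>\<delta>>0. limsup (tau_bar P X \<Theta> M' \<theta> \<delta>) < 1 \<longrightarrow> LLN P X M' \<theta> \<delta>) \<longrightarrow>
      (\<forall>\<theta>_tilde. closest_root_estimator P X \<Theta> M \<theta> \<theta>_tilde \<longrightarrow>
        weak_conv_m
          (\<lambda>n. distr (P n) borel
             (\<lambda>\<omega>. J_n P X M' \<theta> n / sqrt (I_n P X M \<theta> n) * (\<theta>_tilde n \<omega> - \<theta>)))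
          std_normal_distribution))"
proof (intro conjI impI allI)
  interpret estimating_functions P S X M M' \<Theta> \<theta>
    by (rule estimating_functions.intro) fact+
  {
    assume inf: "(\<forall>\<^sub>F n in sequentially. J_n P X M' \<theta> n > 0) \<longrightarrow>
      LLN P X (\<lambda>n i t x. - M' n i t x) \<theta> \<delta>\<^sub>\<theta>"
    from c_sign show "whp P (\<lambda>n \<omega>.
        (J_n P X M' \<theta> n < 0 \<longrightarrow> strict_antimono_on (onbhd \<theta> \<delta>\<^sub>\<theta>) (M_n X M n \<omega>)) \<and>
        (J_n P X M' \<theta> n > 0 \<longrightarrow> strict_mono_on (onbhd \<theta> \<delta>\<^sub>\<theta>) (M_n X M n \<omega>)) \<and>
        (\<exists>s\<in>onbhd \<theta> \<delta>\<^sub>\<theta>. \<exists>t\<in>onbhd \<theta> \<delta>\<^sub>\<theta>. M_n X M n \<omega> s < 0 \<and> 0 < M_n X M n \<omega> t) \<and>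
        (\<exists>!t. t \<in> onbhd \<theta> \<delta>\<^sub>\<theta> \<and> M_n X M n \<omega> t = 0) \<and>
        (\<exists>t\<in>onbhd \<theta> \<delta>\<^sub>\<theta>. closest_root \<Theta> (M_n X M n \<omega>) \<theta> t))"
    proof
      assume neg: "\<forall>\<^sub>F n in sequentially. J_n P X M' \<theta> n < 0"
      show ?thesis
        by (rule whp_mono[OF whp_strict_antimono_root[OF neg d_delta d_tau d_lln]]) auto
    next
      assume pos: "\<forall>\<^sub>F n in sequentially. J_n P X M' \<theta> n > 0"
      \<comment> \<open>The supremum of \<open>- M'\<close> is minus the infimum of
        \<open>M'\<close>. The law of large numbers in \<open>inf\<close> thus supplies the lower
        bound on the slope of \<open>F\<close> that positive \<open>J\<close> calls for.\<close>
      interpret neg: estimating_functions P S X "\<lambda>n i t x. - M n i t x" "\<lambda>n i t x. - M' n i t x" \<Theta> \<theta>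
        by (rule uminus)
      have "\<forall>\<^sub>F n in sequentially. neg.J n < 0" using pos by (simp add: J_n_uminus)
      from neg.whp_strict_antimono_root[OF this d_delta] d_tau inf pos
      have "whp P (\<lambda>n \<omega>. strict_mono_on (onbhd \<theta> \<delta>\<^sub>\<theta>) (F n \<omega>) \<and>
        (\<exists>s\<in>onbhd \<theta> \<delta>\<^sub>\<theta>. \<exists>t\<in>onbhd \<theta> \<delta>\<^sub>\<theta>. 0 < F n \<omega> s \<and> F n \<omega> t < 0) \<and>
        (\<exists>!t. t \<in> onbhd \<theta> \<delta>\<^sub>\<theta> \<and> F n \<omega> t = 0) \<and>
        (\<exists>t\<in>onbhd \<theta> \<delta>\<^sub>\<theta>. closest_root \<Theta> (F n \<omega>) \<theta> t) \<and> 0 < J n)"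
        by (simp add: tau_bar_uminus J_n_uminus M_n_uminus closest_root_uminus monotone_on_def)
      then show ?thesis by (rule whp_mono) (use order.asym in blast)
    qed
  next
    fix T
    assume tau: "((\<lambda>\<delta>. limsup (tau_bar P X \<Theta> M' \<theta> (ereal \<delta>))) \<longlongrightarrow> 0) (at_right 0) \<and>
        (\<forall>\<delta>>0. limsup (tau_bar P X \<Theta> M' \<theta> \<delta>) < 1 \<longrightarrow> LLN P X M' \<theta> \<delta>)"
      and T: "closest_root_estimator P X \<Theta> M \<theta> T"
    let ?W = "\<lambda>n \<omega>. F n \<omega> \<theta> / sqrt (I n)" and ?Z = "\<lambda>n \<omega>. J n / sqrt (I n) * (T n \<omega> - \<theta>)"
    have [measurable]: "T n \<in> borel_measurable (P n)" for n
      using T by (simp add: closest_root_estimator_def)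
    \<comment> \<open>The linearization shows that \<open>?W + ?Z\<close> vanishes in probability,
      so \<open>?Z\<close> inherits the limit of \<open>- ?W\<close>; symmetry of the normal law
      removes the sign.\<close>
    show "weak_conv_m (\<lambda>n. distr (P n) borel (?Z n)) std_normal_distribution"
    proof (rule weak_conv_m_reflect[OF prob, where W = ?W])
      show "char std_normal_distribution (- t) = char std_normal_distribution t" for t
        by (simp add: char_std_normal_distribution)
      show "weak_conv_m (\<lambda>n. distr (P n) borel (?W n)) std_normal_distribution"
        using b_clt by (simp add: M_n_def)
      show "conv_in_prob P (\<lambda>n \<omega>. ?W n \<omega> + ?Z n \<omega>) 0"
        using closest_root_linearization[OF _ conjunct1[OF tau] T] b_lln by (simp add: M_n_def)
    qed (auto intro: real_dist_normal_dist)
  }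
qed

end
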